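(* Let the solution $v\in C^5((0,T])$ and let $v_{\mathbf 3}^n$ be the discrete solution of the BDF2-DC3 scheme. If $\tau\le 1/(4L_f)$ and $f\in C^2$, the numerical solution $v_{\mathbf 4}^n$ of the BDF2-DC3-DC4 scheme is convergent in the sense that, for $3\le n\le N$, $$|e_{\mathbf 4}^{n}|\le C r_{\max}\exp(4L_ft_{n-1})\Big(|e_{\mathbf 4}^{2}|+\tau|\partial_\tau e_{\mathbf 4}^2|+t_n\tau^4+\tau|e_{\mathbf 3}^{1}|+\tau(\tau+\sigma_{\mathbf 3}^n)|\partial_\tau e_{\mathbf 3}^1|+\tau^2|e_{\mathbf 2}^1|+\tau^2(\tau+\sigma_{\mathbf 4}^n)|\partial_\tau e_{\mathbf 2}^1|\Big),$$ where $C>0$ is independent of the time-step sizes $\tau_n$ and of the step ratios $r_n$.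
   Context: Problem: $v'(t)=f(t,v)$ for $0<t\le T$, $v(0)=v_0$, where $f$ is Lipschitz-continuous in $v$ with Lipschitz constant $L_f>0$; $v(t)$ denotes its exact solution. Mesh: $0=t_0<t_1<\cdots<t_N=T$ is an arbitrary mesh, $\tau_k:=t_k-t_{k-1}$ for $1\le k\le N$, $\tau:=\max_{1\le k\le N}\tau_k$, $r_k:=\tau_k/\tau_{k-1}$ for $k\ge2$, $r_{\max}:=\max_{k\ge2}r_k$. For a sequence $(w^n)$ put $\partial_\tau w^n:=(w^n-w^{n-1})/\tau_n$. BDF2 operator: $D_2w^n:=\sum_{j=1}^n d^{(n)}_{n-j}\partial_\tau w^j$ for $n\ge2$, with $d^{(n)}_0:=\frac{1+2r_n}{1+r_n}$, $d^{(n)}_1:=-\frac{r_n}{1+r_n}$, $d^{(n)}_j:=0$ for $j\ge2$. DOC kernels: $\vartheta_0^{(n)}:=1/d_0^{(n)}$ and $\vartheta_{n-j}^{(n)}:=-\frac1{d_0^{(j)}}\sum_{i=j+1}^n\vartheta_{n-i}^{(n)}d^{(i)}_{i-j}$ for $2\le j\le n-1$. For $n\ge2$ define $\sigma_{\mathbf 2}^n:=\prod_{\ell=2}^n\frac{r_\ell}{1+2r_\ell}$, $\sigma_{\mathbf 3}^n:=\sum_{i=2}^n\vartheta_{n-i}^{(n)}\sigma_{\mathbf 2}^i$, $\sigma_{\mathbf 4}^n:=\sum_{i=2}^n\vartheta_{n-i}^{(n)}\sigma_{\mathbf 3}^i$. Corrections, with $f[\cdot,\ldots,\cdot]$ the Newton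 divided differences of the data $f(t_k,w^k)$ at $t_k$: $\mathcal D_{2,3}f(t_n,w^n):=\frac13\big[r_n(\tau_n+\tau_{n-1})^2-(1+r_n)\tau_n^2\big]f[t_n,t_{n-1},t_{n-2}]$ for $n\ge2$ (equivalently $\frac{\tau_n}{3}(\partial_\tau f(t_n,w^n)-\partial_\tau f(t_{n-1},w^{n-1}))$), and $\mathcal D_{2,4}f(t_n,w^n):=\mathcal D_{2,3}f(t_n,w^n)+\frac{\tau_n}{12}(\tau_n+\tau_{n-1})(2\tau_n+\tau_{n-1})f[t_n,t_{n-1},t_{n-2},t_{n-3}]$ for $n\ge3$. Schemes, with $v_{\mathbf 2}^0=v_{\mathbf 3}^0=v_{\mathbf 4}^0=v_0$ and given starting values $v_{\mathbf 2}^1,v_{\mathbf 3}^1,v_{\mathbf 4}^1,v_{\mathbf 4}^2$: BDF2: $D_2v_{\mathbf 2}^n=f(t_n,v_{\mathbf 2}^n)$ for $n\ge2$; BDF2-DC3: $D_2v_{\mathbf 3}^n+\mathcal D_{2,3}f(t_n,v_{\mathbf 2}^n)=f(t_n,v_{\mathbf 3}^n)$ for $n\ge2$; BDF2-DC3-DC4: $D_2v_{\mathbf 4}^n+\mathcal D_{2,4}f(t_n,v_{\mathbf 3}^n)=f(t_n,v_{\mathbf 4}^n)$ for $n\ge3$. Errors: $e_{\mathbf q}^0:=0$, $e_{\mathbf q}^i:=v(t_i)-v_{\mathbf q}^i$ for $\mathbf q=\mathbf 2,\mathbf 3,\mathbf 4$ and $1\le i\le N$. Convention: $C$ denotes a generic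 positive constant which may depend on the given data, the solution and the length of the integration interval, but is always independent of the time-step sizes $\tau_n$ and the step ratios $r_n$. The starting values are always assumed available and accurate.
   Formalization: The factor r_max is replaced by max(1, r_max), as the bound fails for small r_max; the fifth derivative of v is assumed bounded on (0,T]; "accurate" starting values means |e_q^1| + τ|∂_τ e_q^1| ≤ M for q = 2, 3, with M arbitrary and C depending on M. *)

theory Defs
  imports "HOL-Analysis.Analysis"
begin

section \<open>Regularity\<close>

text \<open>
  Derivatives are taken relative to \<open>S\<close>, so on \<open>(0,T]\<close> the derivative at \<open>T\<close> is one-sided.
\<close>

primrec deriv_on :: "nat \<Rightarrow> real set \<Rightarrow> (real \<Rightarrow> real) \<Rightarrow> real \<Rightarrow> real" where
  "deriv_on 0 S g = g"
| "deriv_on (Suc k) S g = (\<lambda>x. vector_derivative (deriv_on k S g) (at x within S))"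

definition Ck_on :: "nat \<Rightarrow> real set \<Rightarrow> (real \<Rightarrow> real) \<Rightarrow> bool" where
  "Ck_on k S g \<longleftrightarrow>
     (\<forall>i<k. \<forall>x\<in>S. deriv_on i S g differentiable (at x within S)) \<and>
     continuous_on S (deriv_on k S g)"

text \<open>Twice continuous Frechet differentiability, relative to the set \<open>S\<close>.\<close>

definition C2_on :: "'a::real_normed_vector set \<Rightarrow> ('a \<Rightarrow> 'b::real_normed_vector) \<Rightarrow> bool" where
  "C2_on S g \<longleftrightarrow>
     (\<exists>(g' :: 'a \<Rightarrow> 'a \<Rightarrow>\<^sub>L 'b) (g'' :: 'a \<Rightarrow> 'a \<Rightarrow>\<^sub>L 'a \<Rightarrow>\<^sub>L 'b).
        (\<forall>x\<in>S. (g has_derivative blinfun_apply (g' x)) (at x within S)) \<and>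
        (\<forall>x\<in>S. (g' has_derivative blinfun_apply (g'' x)) (at x within S)) \<and>
        continuous_on S g'')"

definition solves_ivp ::
  "(real \<Rightarrow> real \<Rightarrow> real) \<Rightarrow> real \<Rightarrow> real \<Rightarrow> (real \<Rightarrow> real) \<Rightarrow> bool" where
  "solves_ivp f T v0 v \<longleftrightarrow>
     v 0 = v0 \<and> continuous_on {0..T} v \<and>
     (\<forall>s\<in>{0<..T}. (v has_real_derivative f s (v s)) (at s within {0..T}))"


section \<open>Meshes\<close>

definition mesh :: "real \<Rightarrow> nat \<Rightarrow> (nat \<Rightarrow> real) \<Rightarrow> bool" where
  "mesh T N t \<longleftrightarrow> t 0 = 0 \<and> t N = T \<and> (\<forall>k\<in>{1..N}. t (k - 1) < t k)"

definition step :: "(nat \<Rightarrow> real) \<Rightarrow> nat \<Rightarrow> real" where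
  "step t k = t k - t (k - 1)"

definition max_step :: "nat \<Rightarrow> (nat \<Rightarrow> real) \<Rightarrow> real" where
  "max_step N t = Max (step t ` {1..N})"

definition ratio :: "(nat \<Rightarrow> real) \<Rightarrow> nat \<Rightarrow> real" where
  "ratio t k = step t k / step t (k - 1)"

definition max_ratio :: "nat \<Rightarrow> (nat \<Rightarrow> real) \<Rightarrow> real" where
  "max_ratio N t = Max (ratio t ` {2..N})"

definition diffq :: "(nat \<Rightarrow> real) \<Rightarrow> (nat \<Rightarrow> real) \<Rightarrow> nat \<Rightarrow> real" where
  "diffq t w n = (w n - w (n - 1)) / step t n"

text \<open>\<open>divdiff t y k n\<close> is the Newton divided difference \<open>y[t\<^sub>n, t\<^sub>n\<^sub>-\<^sub>1, \<dots>, t\<^sub>n\<^sub>-\<^sub>k]\<close>.\<close>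

primrec divdiff :: "(nat \<Rightarrow> real) \<Rightarrow> (nat \<Rightarrow> real) \<Rightarrow> nat \<Rightarrow> nat \<Rightarrow> real" where
  "divdiff t y 0 n = y n"
| "divdiff t y (Suc k) n =
     (divdiff t y k n - divdiff t y k (n - 1)) / (t n - t (n - Suc k))"


section \<open>The BDF2 operator and its discrete orthogonal convolution kernels\<close>

text \<open>\<open>bdf2_kernel t n j\<close> is the kernel with subscript \<open>j\<close> and superscript \<open>(n)\<close>.\<close>

definition bdf2_kernel :: "(nat \<Rightarrow> real) \<Rightarrow> nat \<Rightarrow> nat \<Rightarrow> real" where
  "bdf2_kernel t n j =
     (if j = 0 then (1 + 2 * ratio t n) / (1 + ratio t n)
      else if j = 1 then - (ratio t n / (1 + ratio t n))
      else 0)"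

definition bdf2_op :: "(nat \<Rightarrow> real) \<Rightarrow> (nat \<Rightarrow> real) \<Rightarrow> nat \<Rightarrow> real" where
  "bdf2_op t w n = (\<Sum>j=1..n. bdf2_kernel t n (n - j) * diffq t w j)"

text \<open>
  \<open>doc_kernel t n j\<close> is \<open>\<vartheta>\<close> with superscript \<open>(n)\<close> and subscript \<open>n - j\<close>; the second
  argument is thus \<open>j\<close> itself and not the subscript. It is used for \<open>2 \<le> j \<le> n\<close> only.
\<close>

function doc_kernel :: "(nat \<Rightarrow> real) \<Rightarrow> nat \<Rightarrow> nat \<Rightarrow> real" where
  "doc_kernel t n j =
     (if n \<le> j then 1 / bdf2_kernel t n 0
      else - (1 / bdf2_kernel t j 0) *
             (\<Sum>i=j+1..n. doc_kernel t n i * bdf2_kernel t i (i - j)))"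
  by pat_completeness auto
termination
  by (relation "Wellfounded.measure (\<lambda>(t, n, j). n - j)") auto

declare doc_kernel.simps [simp del]

definition sigma2 :: "(nat \<Rightarrow> real) \<Rightarrow> nat \<Rightarrow> real" where
  "sigma2 t n = (\<Prod>l=2..n. ratio t l / (1 + 2 * ratio t l))"

definition sigma3 :: "(nat \<Rightarrow> real) \<Rightarrow> nat \<Rightarrow> real" where
  "sigma3 t n = (\<Sum>i=2..n. doc_kernel t n i * sigma2 t i)"

definition sigma4 :: "(nat \<Rightarrow> real) \<Rightarrow> nat \<Rightarrow> real" where
  "sigma4 t n = (\<Sum>i=2..n. doc_kernel t n i * sigma3 t i)"


section \<open>Deferred corrections and schemes\<close>

definition corr23 ::
  "(real \<Rightarrow> real \<Rightarrow> real) \<Rightarrow> (nat \<Rightarrow> real) \<Rightarrow> (nat \<Rightarrow> real) \<Rightarrow> nat \<Rightarrow> real" where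
  "corr23 f t w n =
     1 / 3 * (ratio t n * (step t n + step t (n - 1))\<^sup>2 - (1 + ratio t n) * (step t n)\<^sup>2)
       * divdiff t (\<lambda>k. f (t k) (w k)) 2 n"

definition corr24 ::
  "(real \<Rightarrow> real \<Rightarrow> real) \<Rightarrow> (nat \<Rightarrow> real) \<Rightarrow> (nat \<Rightarrow> real) \<Rightarrow> nat \<Rightarrow> real" where
  "corr24 f t w n =
     corr23 f t w n +
     step t n / 12 * (step t n + step t (n - 1)) * (2 * step t n + step t (n - 1))
       * divdiff t (\<lambda>k. f (t k) (w k)) 3 n"

text \<open>
  The starting values of the three schemes (\<open>w 1\<close>, and also \<open>w 2\<close> in the last one) are
  not constrained by these predicates.
\<close>

definition bdf2_scheme ::
  "(real \<Rightarrow> real \<Rightarrow> real) \<Rightarrow> real \<Rightarrow> nat \<Rightarrow> (nat \<Rightarrow> real) \<Rightarrow> (nat \<Rightarrow> real) \<Rightarrow> bool" where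
  "bdf2_scheme f v0 N t w \<longleftrightarrow>
     w 0 = v0 \<and> (\<forall>n\<in>{2..N}. bdf2_op t w n = f (t n) (w n))"

definition bdf2_dc3_scheme ::
  "(real \<Rightarrow> real \<Rightarrow> real) \<Rightarrow> real \<Rightarrow> nat \<Rightarrow> (nat \<Rightarrow> real) \<Rightarrow>
   (nat \<Rightarrow> real) \<Rightarrow> (nat \<Rightarrow> real) \<Rightarrow> bool" where
  "bdf2_dc3_scheme f v0 N t v2 w \<longleftrightarrow>
     w 0 = v0 \<and> (\<forall>n\<in>{2..N}. bdf2_op t w n + corr23 f t v2 n = f (t n) (w n))"

definition bdf2_dc3_dc4_scheme ::
  "(real \<Rightarrow> real \<Rightarrow> real) \<Rightarrow> real \<Rightarrow> nat \<Rightarrow> (nat \<Rightarrow> real) \<Rightarrow>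
   (nat \<Rightarrow> real) \<Rightarrow> (nat \<Rightarrow> real) \<Rightarrow> bool" where
  "bdf2_dc3_dc4_scheme f v0 N t v3 w \<longleftrightarrow>
     w 0 = v0 \<and> (\<forall>n\<in>{3..N}. bdf2_op t w n + corr24 f t v3 n = f (t n) (w n))"

definition err :: "(real \<Rightarrow> real) \<Rightarrow> (nat \<Rightarrow> real) \<Rightarrow> (nat \<Rightarrow> real) \<Rightarrow> nat \<Rightarrow> real" where
  "err v t w i = (if i = 0 then 0 else v (t i) - w i)"

text \<open>
  Accuracy of the starting value \<open>w 1\<close>: its contribution to the error is at most \<open>M\<close>.
  Since \<open>f\<close> is \<open>C\<^sup>2\<close> but its second derivatives may be unbounded on \<open>[0,T] \<times> \<real>\<close>, error
  constants that depend on these derivatives can be uniform only under such a bound.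
\<close>

definition start_accurate ::
  "real \<Rightarrow> (real \<Rightarrow> real) \<Rightarrow> nat \<Rightarrow> (nat \<Rightarrow> real) \<Rightarrow> (nat \<Rightarrow> real) \<Rightarrow> bool" where
  "start_accurate M v N t w \<longleftrightarrow>
     \<bar>err v t w 1\<bar> + max_step N t * \<bar>diffq t (err v t w) 1\<bar> \<le> M"

end

theory Submission
  imports Defs
begin

text \<open>
  Put \<open>a\<^sub>k = r\<^sub>k / (1 + 2 r\<^sub>k) \<le> 1/2\<close>. The equation \<open>D\<^sub>2 w\<^sup>k = g\<^sup>k\<close> is equivalent to
  \<open>z\<^sub>k = a\<^sub>k z\<^sub>k\<^sub>-\<^sub>1 + (1 - a\<^sub>k) g\<^sup>k\<close> for the difference quotients \<open>z\<^sub>k\<close> of \<open>w\<close>: a convex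
  combination, whatever the step ratios are. Hence a source bounded by \<open>L |e\<^sup>k| + A + p\<^sub>k\<close> gives
  \<open>|z\<^sub>k| \<le> L max |e| + A + P\<^sub>k\<close>, where \<open>P\<close> solves the same recursion with source \<open>p\<close>, and a
  discrete Gronwall argument bounds \<open>|e\<^sup>n|\<close>. Each deferred correction feeds the difference
  quotients of the previous error into the source, which turns \<open>\<sigma>\<^sub>2\<close> into \<open>\<sigma>\<^sub>3\<close> and \<open>\<sigma>\<^sub>3\<close> into
  \<open>\<sigma>\<^sub>4\<close>, all summable because \<open>a\<^sub>k \<le> 1/2\<close>. Shifting an index back costs a factor
  \<open>1 / a\<^sub>k = 2 + \<tau>\<^sub>k\<^sub>-\<^sub>1 / \<tau>\<^sub>k\<close>, which the step size in front of the correction absorbs; only the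
  third divided difference leaves a factor \<open>r\<^sub>m\<^sub>a\<^sub>x\<close>.
\<close>

section \<open>Regularity of the solution\<close>

text \<open>The constant must be fixed before the mesh, yet the corrections difference
  \<open>f\<close> along numerical solutions, and the second derivatives of \<open>f\<close> are
  bounded only on compact sets. The size of these sets comes from a priori bounds:
  \<open>start_accurate\<close> bounds the error of \<open>v2\<close>, which gives a constant
  \<open>Q2\<close> for the mixed differences of \<open>f\<close>; \<open>Q2\<close> enters the
  bound for the error of \<open>v3\<close>, which gives \<open>Q3\<close>. Mixed differences keep
  inverse steps out. Over one step the increment of f(s, v) - f(s, w) is bounded by the increment of
  the error plus the error times the step, so its quotient contains only the error and its
  difference quotient. In each difference quotient the damped part is kept apart from the uniform
  part. Weighted with steps of size at most \<tau>, a summable damped part contributes a multiple of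
  \<tau>, while a uniform part contributes a multiple of t_n. This is the origin of the factor
  \<tau> in front of the starting difference quotients and of t_n in front of the truncation
  error.\<close>

text \<open>
  The remainders are controlled through their increments and not pointwise: their difference
  quotients then stay small no matter how short the step is.
\<close>

definition quartic_expansion ::
  "(real \<Rightarrow> real \<Rightarrow> real) \<Rightarrow> (real \<Rightarrow> real) \<Rightarrow> real \<Rightarrow> real \<Rightarrow> bool" where
  "quartic_expansion f v T B \<longleftrightarrow>
    (\<forall>c\<in>{0<..T}. \<exists>a3 a4. \<exists>a2 P \<rho>.
     \<bar>a3\<bar> \<le> B \<and> \<bar>a4\<bar> \<le> B \<and>
     (\<forall>x. f x (v x) = f c (v c) + a2 * (x - c) + a3 * (x - c)^2 + a4 * (x - c)^3 + \<rho> x) \<and>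
     (\<forall>x. v x = v c + f c (v c) * (x - c) + a2 / 2 * (x - c)^2 + a3 / 3 * (x - c)^3
                + a4 / 4 * (x - c)^4 + P x) \<and>
     (\<forall>x y. 0 \<le> x \<longrightarrow> x < y \<longrightarrow> y \<le> c \<longrightarrow>
        \<bar>P y - P x\<bar> \<le> B * (c - x)^4 * (y - x) \<and> \<bar>\<rho> y - \<rho> x\<bar> \<le> B * (c - x)^3 * (y - x)))"

text \<open>For neighbouring mesh points \<open>s\<close>, \<open>s'\<close> with errors
  \<open>d\<close>, \<open>e\<close>, division by |s' - s| leaves |d| + |e| and the difference
  quotient of the error. The radius \<open>D\<close> is a parameter because a uniform
  \<open>Q\<close> is available only for errors in a bounded range.\<close>

definition mixed_difference_bound ::
  "(real \<Rightarrow> real \<Rightarrow> real) \<Rightarrow> (real \<Rightarrow> real) \<Rightarrow> real \<Rightarrow> real \<Rightarrow> real \<Rightarrow> bool" where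
  "mixed_difference_bound f v T D Q \<longleftrightarrow>
    (\<forall>s\<in>{0..T}. \<forall>s'\<in>{0..T}. \<forall>d e. \<bar>d\<bar> \<le> D \<longrightarrow> \<bar>e\<bar> \<le> D \<longrightarrow>
      \<bar>(f s' (v s') - f s' (v s' - e)) - (f s (v s) - f s (v s - d))\<bar>
      \<le> Q * ((\<bar>d\<bar> + \<bar>e\<bar>) * \<bar>s' - s\<bar> + \<bar>e - d\<bar>))"

text \<open>The derivative is required only in the open interval: at 0 the solution is merely
  assumed continuous, and the first mesh interval starts there.\<close>

lemma abs_diff_le_of_deriv_bound:
  fixes h h' :: "real \<Rightarrow> real"
  assumes "x < y" and "continuous_on {x..y} h"
    and deriv: "\<And>z. x < z \<Longrightarrow> z < y \<Longrightarrow> (h has_real_derivative h' z) (at z)"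
    and bound: "\<And>z. x < z \<Longrightarrow> z < y \<Longrightarrow> \<bar>h' z\<bar> \<le> K"
  shows "\<bar>h y - h x\<bar> \<le> K * (y - x)"
proof -
  obtain z where z: "x < z" "z < y" "h y - h x = h' z * (y - x)"
  proof (rule mvt[OF assms(1,2)])
    show "(h has_derivative (*) (h' z)) (at z)" if "x < z" "z < y" for z
      using deriv[OF that] by (simp add: has_field_derivative_def)
  qed
  then show ?thesis
    using bound[of z] \<open>x < y\<close> by (simp add: abs_mult mult_right_mono)
qed

lemma Ck_on_has_real_derivative:
  assumes "Ck_on k S g" "i < k" "x \<in> S"
  shows "(deriv_on i S g has_real_derivative deriv_on (Suc i) S g x) (at x within S)"
  using assms
  by (auto simp: Ck_on_def has_real_derivative_iff_has_vector_derivative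
      simp flip: vector_derivative_works)

text \<open>A bounded derivative on a bounded convex set makes the function Lipschitz, hence
  bounded, so boundedness descends from the highest derivative. Continuity alone would not give it,
  since \<open>{0<..T}\<close> is not compact.\<close>

lemma bounded_lower_derivs:
  assumes "Ck_on k S g" and S: "convex S" "bounded S"
    and "bounded (deriv_on k S g ` S)" and "i \<le> k"
  shows "bounded (deriv_on i S g ` S)"
  using \<open>i \<le> k\<close>
proof (induction i rule: inc_induct)
  case base
  then show ?case by fact
next
  case (step i)
  obtain B where B: "\<And>x. x \<in> S \<Longrightarrow> \<bar>deriv_on (Suc i) S g x\<bar> \<le> B"
    using step.IH unfolding bounded_iff by (force simp del: deriv_on.simps)
  obtain D where D: "\<And>x. x \<in> S \<Longrightarrow> \<bar>x\<bar> \<le> D"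
    using \<open>bounded S\<close> unfolding bounded_iff by auto
  show ?case
  proof (cases "S = {}")
    case False
    then obtain c where c: "c \<in> S" by blast
    have "\<bar>deriv_on i S g x\<bar> \<le> \<bar>deriv_on i S g c\<bar> + B * (2 * D)" if "x \<in> S" for x
    proof -
      have "norm (deriv_on i S g x - deriv_on i S g c) \<le> B * norm (x - c)"
        by (rule field_differentiable_bound[OF \<open>convex S\<close> Ck_on_has_real_derivative])
          (use assms step B c that in \<open>auto simp del: deriv_on.simps\<close>)
      moreover have "B * norm (x - c) \<le> B * (2 * D)"
        using D[OF that] D[OF c] B[OF c] by (intro mult_left_mono) auto
      ultimately show ?thesis by simp
    qed
    then show ?thesis unfolding bounded_iff by fastforce
  qed simp
qed

lemma C2_on_continuous:
  assumes "C2_on S g" shows "continuous_on S g"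
  using assms unfolding C2_on_def
  by (meson has_derivative_continuous continuous_on_eq_continuous_within)

lemma solution_continuous_rhs:
  fixes f :: "real \<Rightarrow> real \<Rightarrow> real"
  assumes "C2_on ({0..T} \<times> UNIV) (\<lambda>(s, x). f s x)" and "continuous_on {0..T} v"
  shows "continuous_on {0..T} (\<lambda>x. f x (v x))"
proof -
  have "continuous_on {0..T} ((\<lambda>(s, x). f s x) \<circ> (\<lambda>x. (x, v x)))"
    by (intro continuous_on_compose continuous_intros assms(2))
      (rule continuous_on_subset[OF C2_on_continuous[OF assms(1)]], auto)
  then show ?thesis by (simp add: o_def)
qed

text \<open>Because v' = f(x, v x), the right-hand side along the solution is expanded with
  derivatives of v: the coefficients are v''(c), v'''(c)/2 and v''''(c)/6, and term-by-term
  integration gives those of v. By construction P' = \<rho>, and \<rho>' is the Taylor remainder of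
  v''. Both \<rho> and \<rho>' are bounded by the fifth derivative, and the mean value theorem turns
  this into increments of \<open>P\<close> and \<rho>.\<close>

lemma solution_taylor:
  fixes f :: "real \<Rightarrow> real \<Rightarrow> real" and v :: "real \<Rightarrow> real" and T v0 :: real
  assumes T: "T > 0"
    and f_C2: "C2_on ({0..T} \<times> UNIV) (\<lambda>(s, x). f s x)"
    and v_sol: "solves_ivp f T v0 v"
    and v_C5: "Ck_on 5 {0<..T} v"
    and v_C5_bounded: "bounded (deriv_on 5 {0<..T} v ` {0<..T})"
  shows "\<exists>B\<ge>0. quartic_expansion f v T B"
proof -
  define S where "S = {0<..T}"
  define V where "V = (\<lambda>i. deriv_on i S v)"
  have S: "convex S" "bounded S"
    by (auto simp: S_def)
  have "\<exists>B. \<forall>x\<in>S. \<bar>V i x\<bar> \<le> B" if "i \<le> 5" for i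
    using bounded_lower_derivs[OF v_C5[folded S_def] S v_C5_bounded[folded S_def] that]
    by (auto simp: bounded_iff V_def)
  then obtain b where b: "\<And>i x. i \<le> 5 \<Longrightarrow> x \<in> S \<Longrightarrow> \<bar>V i x\<bar> \<le> b i"
    by metis
  define B where "B = (\<Sum>i\<le>5. \<bar>b i\<bar>)"
  have VB: "\<bar>V i x\<bar> \<le> B" if "i \<le> 5" "x \<in> S" for i x
  proof -
    have "\<bar>b i\<bar> \<le> B"
      unfolding B_def by (rule member_le_sum) (use that in auto)
    then show ?thesis using b[OF that] by simp
  qed
  have B0: "B \<ge> 0" by (simp add: B_def sum_nonneg)
  have der: "(V i has_real_derivative V (Suc i) x) (at x within S)" if "i < 5" "x \<in> S" for i x
    using Ck_on_has_real_derivative[OF v_C5[folded S_def] that] by (simp add: V_def)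
  have V0: "V 0 = v" by (simp add: V_def)
  have V1: "V 1 x = f x (v x)" if "x \<in> S" for x
  proof -
    have "(v has_real_derivative f x (v x)) (at x within {0..T})"
      using v_sol that by (auto simp: solves_ivp_def S_def)
    then have *: "(v has_real_derivative f x (v x)) (at x within S)"
      by (rule DERIV_subset) (auto simp: S_def)
    \<comment> \<open>A derivative relative to \<open>S\<close> is unique only at limit points of
      \<open>S\<close>. Every point of \<open>{0<..T}\<close>, including \<open>T\<close>, is a
      limit of points to its left.\<close>
    have "at x within S \<noteq> bot"
      using that islimpt_subset[OF islimpt_greaterThanLessThan2[of 0 x], of S]
      by (force simp: S_def trivial_limit_within)
    then show ?thesis
      using vector_derivative_unique_within[of x S v "V 1 x" "f x (v x)"] * der[of 0 x] that V0
      by (simp add: has_real_derivative_iff_has_vector_derivative)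
  qed
  have cont_v: "continuous_on {0..T} v"
    using v_sol by (simp add: solves_ivp_def)
  have cont_F: "continuous_on {0..T} (\<lambda>x. f x (v x))"
    by (rule solution_continuous_rhs[OF f_C2 cont_v])
  have at_z: "at z within S = at z" if "0 < z" "z < T" for z
    using that by (intro at_within_open_subset[of z "{0<..<T}"]) (auto simp: S_def)
  show ?thesis
    unfolding quartic_expansion_def
  proof (rule exI[of _ B], intro conjI ballI B0)
    fix c assume "c \<in> {0<..T}"
    then have c: "c \<in> S" "0 < c" "c \<le> T" by (auto simp: S_def)
    define \<rho> where "\<rho> = (\<lambda>x. f x (v x) - (V 1 c + V 2 c * (x - c) + V 3 c / 2 * (x - c)^2
        + V 4 c / 6 * (x - c)^3))"
    define \<rho>' where "\<rho>' = (\<lambda>x. V 2 x - (V 2 c + V 3 c * (x - c) + V 4 c / 2 * (x - c)^2))"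
    define P where "P = (\<lambda>x. v x - (v c + V 1 c * (x - c) + V 2 c / 2 * (x - c)^2
        + V 3 c / 2 / 3 * (x - c)^3 + V 4 c / 6 / 4 * (x - c)^4))"
    have sum3: "(\<Sum>i\<le>3. a i * y^i / fact i) = a 0 + a 1 * y + a 2 / 2 * y^2 + a 3 / 6 * y^3"
      and sum2: "(\<Sum>i\<le>2. a i * y^i / fact i) = a 0 + a 1 * y + a 2 / 2 * y^2"
      for a :: "nat \<Rightarrow> real" and y
      by (simp_all add: numeral_eq_Suc)
    have \<rho>_bound: "\<bar>\<rho> x\<bar> \<le> B * (c - x)^4" if "0 < x" "x \<le> c" for x
    proof -
      have x: "x \<in> S" using that c by (auto simp: S_def)
      have "norm (V (Suc 0) x - (\<Sum>i\<le>3. V (Suc i) c * (x - c)^i / fact i))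
            \<le> B * norm (x - c)^(Suc 3) / fact 3"
        by (rule field_Taylor[OF S(1), where f = "\<lambda>i. V (Suc i)"])
          (use der VB c x in auto)
      also have "\<dots> \<le> B * norm (x - c)^(Suc 3) / 1"
        using B0 by (intro divide_left_mono) auto
      also have "norm (x - c) = c - x" using that by simp
      also have "V (Suc 0) x - (\<Sum>i\<le>3. V (Suc i) c * (x - c)^i / fact i) = \<rho> x"
        using V1[OF x] sum3[of "\<lambda>i. V (Suc i) c"] by (simp add: \<rho>_def eval_nat_numeral)
      finally show ?thesis by simp
    qed
    have \<rho>'_bound: "\<bar>\<rho>' x\<bar> \<le> B * (c - x)^3" if "0 < x" "x \<le> c" for x
    proof -
      have x: "x \<in> S" using that c by (auto simp: S_def)
      have "norm (V (Suc (Suc 0)) x - (\<Sum>i\<le>2. V (Suc (Suc i)) c * (x - c)^i / fact i))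
            \<le> B * norm (x - c)^(Suc 2) / fact 2"
        by (rule field_Taylor[OF S(1), where f = "\<lambda>i. V (Suc (Suc i))"])
          (use der VB c x in auto)
      also have "\<dots> \<le> B * norm (x - c)^(Suc 2) / 1"
        using B0 by (intro divide_left_mono) auto
      also have "norm (x - c) = c - x" using that by simp
      also have "V (Suc (Suc 0)) x - (\<Sum>i\<le>2. V (Suc (Suc i)) c * (x - c)^i / fact i) = \<rho>' x"
        using sum2[of "\<lambda>i. V (Suc (Suc i)) c"] by (simp add: \<rho>'_def eval_nat_numeral)
      finally show ?thesis by simp
    qed
    have dP: "(P has_real_derivative \<rho> z) (at z)" if "0 < z" "z < T" for z
    proof -
      have z: "z \<in> S" using that by (auto simp: S_def)
      have dv: "(v has_real_derivative f z (v z)) (at z)"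
        using der[of 0 z] z V0 V1[OF z] at_z[OF that] by simp
      show ?thesis
        unfolding P_def
        by (rule derivative_eq_intros refl dv | simp)+
          (simp add: \<rho>_def power2_eq_square power3_eq_cube field_simps)
    qed
    have d\<rho>: "(\<rho> has_real_derivative \<rho>' z) (at z)" if "0 < z" "z < T" for z
    proof -
      have z: "z \<in> S" using that by (auto simp: S_def)
      have "(V 1 has_real_derivative V 2 z) (at z)"
        using der[of 1 z] z at_z[OF that] by (simp add: numeral_2_eq_2)
      then have dF: "((\<lambda>x. f x (v x)) has_real_derivative V 2 z) (at z)"
      proof (rule has_field_derivative_transform_within_open)
        show "open {0<..<T}" "z \<in> {0<..<T}" using that by auto
        show "V 1 x = f x (v x)" if "x \<in> {0<..<T}" for x
          using that V1[of x] by (auto simp: S_def)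
      qed
      show ?thesis
        unfolding \<rho>_def
        by (rule derivative_eq_intros refl dF | simp)+
          (simp add: \<rho>'_def power2_eq_square field_simps)
    qed
    have main: "\<bar>P y - P x\<bar> \<le> B * (c - x)^4 * (y - x) \<and> \<bar>\<rho> y - \<rho> x\<bar> \<le> B * (c - x)^3 * (y - x)"
      if xy: "0 \<le> x" "x < y" "y \<le> c" for x y
    proof
      have sub: "{x..y} \<subseteq> {0..T}" using xy c by auto
      show "\<bar>P y - P x\<bar> \<le> B * (c - x)^4 * (y - x)"
      proof (rule abs_diff_le_of_deriv_bound[OF \<open>x < y\<close>])
        show "continuous_on {x..y} P"
          unfolding P_def
          by (intro continuous_intros continuous_on_subset[OF cont_v sub])
        show "(P has_real_derivative \<rho> z) (at z)" if "x < z" "z < y" for z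
          using that xy c by (intro dP) auto
        show "\<bar>\<rho> z\<bar> \<le> B * (c - x)^4" if "x < z" "z < y" for z
        proof -
          have "\<bar>\<rho> z\<bar> \<le> B * (c - z)^4" using that xy by (intro \<rho>_bound) auto
          also have "\<dots> \<le> B * (c - x)^4"
            using that xy B0 by (intro mult_left_mono power_mono) auto
          finally show ?thesis .
        qed
      qed
      show "\<bar>\<rho> y - \<rho> x\<bar> \<le> B * (c - x)^3 * (y - x)"
      proof (rule abs_diff_le_of_deriv_bound[OF \<open>x < y\<close>])
        show "continuous_on {x..y} \<rho>"
          unfolding \<rho>_def
          by (intro continuous_intros continuous_on_subset[OF cont_F sub])
        show "(\<rho> has_real_derivative \<rho>' z) (at z)" if "x < z" "z < y" for z
          using that xy c by (intro d\<rho>) auto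
        show "\<bar>\<rho>' z\<bar> \<le> B * (c - x)^3" if "x < z" "z < y" for z
        proof -
          have "\<bar>\<rho>' z\<bar> \<le> B * (c - z)^3" using that xy by (intro \<rho>'_bound) auto
          also have "\<dots> \<le> B * (c - x)^3"
            using that xy B0 by (intro mult_left_mono power_mono) auto
          finally show ?thesis .
        qed
      qed
    qed
    show "\<exists>a3 a4 a2 P \<rho>.
     \<bar>a3\<bar> \<le> B \<and> \<bar>a4\<bar> \<le> B \<and>
     (\<forall>x. f x (v x) = f c (v c) + a2 * (x - c) + a3 * (x - c)^2 + a4 * (x - c)^3 + \<rho> x) \<and>
     (\<forall>x. v x = v c + f c (v c) * (x - c) + a2 / 2 * (x - c)^2 + a3 / 3 * (x - c)^3
                + a4 / 4 * (x - c)^4 + P x) \<and>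
     (\<forall>x y. 0 \<le> x \<longrightarrow> x < y \<longrightarrow> y \<le> c \<longrightarrow>
        \<bar>P y - P x\<bar> \<le> B * (c - x)^4 * (y - x) \<and> \<bar>\<rho> y - \<rho> x\<bar> \<le> B * (c - x)^3 * (y - x))"
    proof (rule exI[of _ "V 3 c / 2"], rule exI[of _ "V 4 c / 6"], rule exI[of _ "V 2 c"],
        rule exI[of _ P], rule exI[of _ \<rho>], intro conjI allI impI)
      show "\<bar>V 3 c / 2\<bar> \<le> B" "\<bar>V 4 c / 6\<bar> \<le> B"
        using VB[of 3 c] VB[of 4 c] c by auto
    qed (use main V1[OF c(1)] in \<open>auto simp: P_def \<rho>_def\<close>)
  qed
qed

section \<open>Mixed differences of the right-hand side along the solution\<close>

lemma solution_lipschitz: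
  fixes f :: "real \<Rightarrow> real \<Rightarrow> real"
  assumes "C2_on ({0..T} \<times> UNIV) (\<lambda>(s, x). f s x)" and v: "solves_ivp f T v0 v"
  obtains K where "K-lipschitz_on {0..T} v"
proof -
  have cont: "continuous_on {0..T} v" using v by (simp add: solves_ivp_def)
  have "bounded ((\<lambda>x. f x (v x)) ` {0..T})"
    by (intro compact_imp_bounded compact_continuous_image
        solution_continuous_rhs[OF assms(1) cont]) simp
  then obtain K where "\<forall>y\<in>(\<lambda>x. f x (v x)) ` {0..T}. norm y \<le> K"
    unfolding bounded_iff by blast
  then have K: "\<bar>f x (v x)\<bar> \<le> K" if "x \<in> {0..T}" for x
    using that by auto
  have less: "\<bar>v y - v x\<bar> \<le> \<bar>K\<bar> * (y - x)" if xy: "x \<in> {0..T}" "y \<in> {0..T}" "x < y" for x y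
  proof (rule abs_diff_le_of_deriv_bound[OF \<open>x < y\<close>])
    show "continuous_on {x..y} v"
      using xy by (auto intro: continuous_on_subset[OF cont])
    fix z assume z: "x < z" "z < y"
    then have "at z within {0..T} = at z"
      using xy by (intro at_within_open_subset[of z "{0<..<T}"]) auto
    moreover have "z \<in> {0<..T}" using z xy by auto
    then have "(v has_real_derivative f z (v z)) (at z within {0..T})"
      using v by (auto simp: solves_ivp_def)
    ultimately show "(v has_real_derivative f z (v z)) (at z)" by simp
    show "\<bar>f z (v z)\<bar> \<le> \<bar>K\<bar>"
      using K[of z] z xy by auto
  qed
  have "\<bar>K\<bar>-lipschitz_on {0..T} v"
  proof (rule lipschitz_onI)
    fix x y assume "x \<in> {0..T}" "y \<in> {0..T}"
    then show "dist (v x) (v y) \<le> \<bar>K\<bar> * dist x y"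
      using less[of x y] less[of y x] by (cases x y rule: linorder_cases) (auto simp: dist_real_def)
  qed simp
  then show thesis by (rule that)
qed

text \<open>Both pairs of points are joined by straight chords \<open>u\<close> and
  \<open>u'\<close>, and the mean value theorem is applied to the difference \<phi> of
  \<open>g\<close> along them, so that both gradients are taken at one common parameter. The
  derivative of \<phi> splits into a difference of gradients applied to \<open>u\<close> and a
  gradient applied to \<open>u - u'\<close>. The first is the distance of the two paths times the
  length of the chord, up to constants; in the second, \<open>u - u'\<close> is just
  \<open>(0, e - d)\<close>.\<close>

lemma C2_on_mixed_difference_bound:
  fixes f :: "real \<Rightarrow> real \<Rightarrow> real" and v :: "real \<Rightarrow> real" and T D :: real
  assumes f_C2: "C2_on ({0..T} \<times> UNIV) (\<lambda>(s, x). f s x)"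
    and v_cont: "continuous_on {0..T} v"
    and v_lip: "K-lipschitz_on {0..T} v"
  shows "\<exists>Q\<ge>0. mixed_difference_bound f v T D Q"
proof -
  let ?S = "{0..T} \<times> (UNIV :: real set)"
  define g where "g = (\<lambda>(s, x). f s x)"
  obtain g' :: "real \<times> real \<Rightarrow> (real \<times> real) \<Rightarrow>\<^sub>L real"
    and g'' :: "real \<times> real \<Rightarrow> (real \<times> real) \<Rightarrow>\<^sub>L ((real \<times> real) \<Rightarrow>\<^sub>L real)"
    where dg: "\<And>x. x \<in> ?S \<Longrightarrow> (g has_derivative blinfun_apply (g' x)) (at x within ?S)"
      and dg': "\<And>x. x \<in> ?S \<Longrightarrow> (g' has_derivative blinfun_apply (g'' x)) (at x within ?S)"
      and cg'': "continuous_on ?S g''"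
    using f_C2 unfolding C2_on_def g_def by metis
  have "bounded (v ` {0..T})"
    by (intro compact_imp_bounded compact_continuous_image v_cont) simp
  then obtain b where "\<forall>y\<in>v ` {0..T}. norm y \<le> b"
    unfolding bounded_iff by blast
  then have b: "\<bar>v x\<bar> \<le> b" if "x \<in> {0..T}" for x
    using that by auto
  \<comment> \<open>Convexity keeps both chords inside \<open>R\<close>, and compactness bounds both
    derivatives of \<open>g\<close> on it. The margin \<open>D\<close> makes room for the perturbed
    points.\<close>
  define R where "R = {0..T} \<times> {- (b + D)..b + D}"
  have R: "compact R" "convex R" "R \<subseteq> ?S"
    by (auto simp: R_def compact_Times convex_Times)
  have "continuous_on ?S g'"
    using dg' has_derivative_continuous continuous_on_eq_continuous_within by metis
  then have "bounded (g' ` R)" "bounded (g'' ` R)"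
    using R cg'' by (auto intro!: compact_imp_bounded compact_continuous_image
        intro: continuous_on_subset)
  then obtain q1 q2 where q: "\<And>x. x \<in> R \<Longrightarrow> norm (g' x) \<le> q1" "\<And>x. x \<in> R \<Longrightarrow> norm (g'' x) \<le> q2"
    by (auto simp: bounded_iff)
  define q where "q = max 0 (max q1 q2)"
  have q0: "q \<ge> 0" and q1: "\<And>x. x \<in> R \<Longrightarrow> norm (g' x) \<le> q"
    and q2: "\<And>x. x \<in> R \<Longrightarrow> norm (g'' x) \<le> q"
    using q by (force simp: q_def)+
  have K0: "K \<ge> 0" using v_lip by (rule lipschitz_on_nonneg)
  define Q where "Q = q * (1 + K) + q"
  have g'_lip: "norm (g' x - g' y) \<le> q * norm (x - y)" if "x \<in> R" "y \<in> R" for x y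
  proof (rule differentiable_bound[OF R(2) _ _ that])
    show "(g' has_derivative blinfun_apply (g'' x)) (at x within R)" if "x \<in> R" for x
      using dg' has_derivative_subset that R by blast
    show "onorm (blinfun_apply (g'' x)) \<le> q" if "x \<in> R" for x
      using q2[OF that] by (simp add: norm_blinfun.rep_eq)
  qed
  show ?thesis
    unfolding mixed_difference_bound_def
  proof (intro exI[of _ Q] conjI ballI allI impI)
    show "Q \<ge> 0" using q0 K0 by (simp add: Q_def)
    fix s t d e :: real
    assume st: "s \<in> {0..T}" "t \<in> {0..T}" and de: "\<bar>d\<bar> \<le> D" "\<bar>e\<bar> \<le> D"
    define p where "p = (s, v s)"
    define u where "u = (t, v t) - p"
    define p' where "p' = (s, v s - d)"
    define u' where "u' = (t, v t - e) - p'"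
    have "(1 - \<theta>) *\<^sub>R p + \<theta> *\<^sub>R (t, v t) \<in> R" "(1 - \<theta>) *\<^sub>R p' + \<theta> *\<^sub>R (t, v t - e) \<in> R"
      if "\<theta> \<in> {0..1}" for \<theta>
      using that st de b[OF st(1)] b[OF st(2)]
      by (intro convexD[OF R(2)]; force simp: p_def p'_def R_def abs_le_iff)+
    then have seg: "p + \<theta> *\<^sub>R u \<in> R" "p' + \<theta> *\<^sub>R u' \<in> R" if "\<theta> \<in> {0..1}" for \<theta>
      using that by (simp_all add: u_def u'_def algebra_simps)
    define \<phi> where "\<phi> = (\<lambda>\<theta>. g (p + \<theta> *\<^sub>R u) - g (p' + \<theta> *\<^sub>R u'))"
    have d\<phi>: "(\<phi> has_derivative (\<lambda>h. g' (p + \<theta> *\<^sub>R u) (h *\<^sub>R u) - g' (p' + \<theta> *\<^sub>R u') (h *\<^sub>R u')))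
                (at \<theta> within {0..1})" if \<theta>: "\<theta> \<in> {0..1}" for \<theta>
    proof -
      have aux: "((\<lambda>\<theta>. g (r + \<theta> *\<^sub>R w)) has_derivative (\<lambda>h. g' (r + \<theta> *\<^sub>R w) (h *\<^sub>R w)))
                (at \<theta> within {0..1})" if r: "\<And>\<theta>. \<theta> \<in> {0..1} \<Longrightarrow> r + \<theta> *\<^sub>R w \<in> R" for r w
      proof (rule has_derivative_in_compose2[where g = g and t = ?S and f = "\<lambda>\<theta>. r + \<theta> *\<^sub>R w"])
        show "(g has_derivative blinfun_apply (g' x)) (at x within ?S)" if "x \<in> ?S" for x
          using dg[OF that] .
        show "(\<lambda>\<theta>. r + \<theta> *\<^sub>R w) ` {0..1} \<subseteq> ?S" using r R(3) by blast
        show "((\<lambda>\<theta>. r + \<theta> *\<^sub>R w) has_derivative (\<lambda>h. h *\<^sub>R w)) (at \<theta> within {0..1})"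
          by (auto intro!: derivative_eq_intros)
      qed (rule \<theta>)
      show ?thesis
        unfolding \<phi>_def by (intro has_derivative_diff aux seg)
    qed
    obtain \<theta> where \<theta>: "\<theta> \<in> {0<..<1}"
      "\<phi> 1 - \<phi> 0 = g' (p + \<theta> *\<^sub>R u) ((1 - 0) *\<^sub>R u) - g' (p' + \<theta> *\<^sub>R u') ((1 - 0) *\<^sub>R u')"
    proof -
      have "\<exists>\<theta>\<in>{0<..<1}. \<phi> 1 - \<phi> 0
          = g' (p + \<theta> *\<^sub>R u) ((1 - 0) *\<^sub>R u) - g' (p' + \<theta> *\<^sub>R u') ((1 - 0) *\<^sub>R u')"
        by (rule mvt_simple) (use d\<phi> in simp_all)
      then show thesis using that by blast
    qed
    have \<theta>': "\<theta> \<in> {0..1}" using \<theta> by simp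
    have "(f t (v t) - f t (v t - e)) - (f s (v s) - f s (v s - d)) = \<phi> 1 - \<phi> 0"
      by (simp add: \<phi>_def u_def u'_def p_def p'_def g_def)
    also have "\<dots> = (g' (p + \<theta> *\<^sub>R u) - g' (p' + \<theta> *\<^sub>R u')) u + g' (p' + \<theta> *\<^sub>R u') (u - u')"
      using \<theta>(2) by (simp add: blinfun.diff_left blinfun.diff_right)
    finally have eq: "(f t (v t) - f t (v t - e)) - (f s (v s) - f s (v s - d))
      = (g' (p + \<theta> *\<^sub>R u) - g' (p' + \<theta> *\<^sub>R u')) u + g' (p' + \<theta> *\<^sub>R u') (u - u')" .
    have "norm ((p + \<theta> *\<^sub>R u) - (p' + \<theta> *\<^sub>R u')) = \<bar>(1 - \<theta>) * d + \<theta> * e\<bar>"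
      by (simp add: p_def p'_def u_def u'_def norm_Pair algebra_simps)
    also have "\<dots> \<le> \<bar>(1 - \<theta>) * d\<bar> + \<bar>\<theta> * e\<bar>" by (rule abs_triangle_ineq)
    also have "\<dots> \<le> \<bar>d\<bar> + \<bar>e\<bar>"
      using \<theta> by (intro add_mono) (auto simp: abs_mult mult_left_le_one_le)
    finally have "norm (g' (p + \<theta> *\<^sub>R u) - g' (p' + \<theta> *\<^sub>R u')) \<le> q * (\<bar>d\<bar> + \<bar>e\<bar>)"
      using g'_lip[OF seg[OF \<theta>']] q0 by (meson mult_left_mono order_trans)
    moreover have "norm u \<le> (1 + K) * \<bar>t - s\<bar>"
    proof -
      have "norm u \<le> norm (t - s) + norm (v t - v s)"
        unfolding u_def p_def using norm_Pair_le[of "t - s" "v t - v s"] by simp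
      then show ?thesis
        using lipschitz_onD[OF v_lip st(2,1)] by (simp add: dist_real_def algebra_simps)
    qed
    ultimately have "norm ((g' (p + \<theta> *\<^sub>R u) - g' (p' + \<theta> *\<^sub>R u')) u)
        \<le> (q * (\<bar>d\<bar> + \<bar>e\<bar>)) * ((1 + K) * \<bar>t - s\<bar>)"
      using q0 by (intro order_trans[OF norm_blinfun] mult_mono) auto
    moreover have "norm (g' (p' + \<theta> *\<^sub>R u') (u - u')) \<le> q * \<bar>e - d\<bar>"
    proof -
      have "u - u' = (0, e - d)" by (simp add: u_def u'_def p_def p'_def)
      then have "norm (u - u') = \<bar>e - d\<bar>" by (simp add: norm_Pair)
      moreover have "norm (g' (p' + \<theta> *\<^sub>R u') (u - u')) \<le> q * norm (u - u')"
        by (rule order_trans[OF norm_blinfun mult_right_mono[OF q1[OF seg(2)[OF \<theta>']]]]) simp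
      ultimately show ?thesis by simp
    qed
    ultimately have "\<bar>(f t (v t) - f t (v t - e)) - (f s (v s) - f s (v s - d))\<bar>
      \<le> (q * (\<bar>d\<bar> + \<bar>e\<bar>)) * ((1 + K) * \<bar>t - s\<bar>) + q * \<bar>e - d\<bar>"
      unfolding eq real_norm_def by (rule abs_triangle_ineq[THEN order_trans, OF add_mono])
    also have "\<dots> \<le> Q * ((\<bar>d\<bar> + \<bar>e\<bar>) * \<bar>t - s\<bar> + \<bar>e - d\<bar>)"
    proof -
      have "q * (1 + K) * \<bar>e - d\<bar> \<ge> 0" "q * ((\<bar>d\<bar> + \<bar>e\<bar>) * \<bar>t - s\<bar>) \<ge> 0"
        using q0 K0 by auto
      then show ?thesis by (simp add: Q_def algebra_simps)
    qed
    finally show "\<bar>(f t (v t) - f t (v t - e)) - (f s (v s) - f s (v s - d))\<bar>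
      \<le> Q * ((\<bar>d\<bar> + \<bar>e\<bar>) * \<bar>t - s\<bar> + \<bar>e - d\<bar>)" .
  qed
qed

section \<open>Convolution kernels on a mesh\<close>

text \<open>The corrections as linear functionals of an arbitrary data sequence, written with first
  difference quotients. Linearity allows the same estimates to serve for the error in the data and
  for Taylor remainders.\<close>

definition dc3 :: "(nat \<Rightarrow> real) \<Rightarrow> (nat \<Rightarrow> real) \<Rightarrow> nat \<Rightarrow> real" where
  "dc3 t y n = step t n / 3 * (diffq t y n - diffq t y (n - 1))"

definition dc4 :: "(nat \<Rightarrow> real) \<Rightarrow> (nat \<Rightarrow> real) \<Rightarrow> nat \<Rightarrow> real" where
  "dc4 t y n = dc3 t y n +
     step t n / 12 * (step t n + step t (n - 1)) * (2 * step t n + step t (n - 1))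
       * ((diffq t y n - diffq t y (n - 1)) / (step t n + step t (n - 1))
          - (diffq t y (n - 1) - diffq t y (n - 2)) / (step t (n - 1) + step t (n - 2)))
       / (step t n + step t (n - 1) + step t (n - 2))"

definition damping :: "(nat \<Rightarrow> real) \<Rightarrow> nat \<Rightarrow> real" where
  "damping t k = ratio t k / (1 + 2 * ratio t k)"

lemma diffq_diff: "diffq t (\<lambda>k. x k - y k) n = diffq t x n - diffq t y n"
  by (simp add: diffq_def diff_divide_distrib)

lemma dc3_diff: "dc3 t (\<lambda>k. x k - y k) n = dc3 t x n - dc3 t y n"
  by (simp add: dc3_def diffq_diff algebra_simps)

lemma dc4_diff: "dc4 t (\<lambda>k. x k - y k) n = dc4 t x n - dc4 t y n"
  by (simp add: dc4_def dc3_diff diffq_diff algebra_simps diff_divide_distrib add_divide_distrib)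

lemma bdf2_op_diff: "bdf2_op t (\<lambda>k. x k - y k) n = bdf2_op t x n - bdf2_op t y n"
  by (simp add: bdf2_op_def diffq_diff algebra_simps sum_subtractf)

lemma bdf2_op_two_terms:
  assumes "n \<ge> 2"
  shows "bdf2_op t w n = bdf2_kernel t n 0 * diffq t w n + bdf2_kernel t n 1 * diffq t w (n - 1)"
proof -
  have "bdf2_op t w n = (\<Sum>j\<in>{n - 1, n}. bdf2_kernel t n (n - j) * diffq t w j)"
    unfolding bdf2_op_def
  proof (rule sum.mono_neutral_right)
    show "\<forall>i\<in>{1..n} - {n - 1, n}. bdf2_kernel t n (n - i) * diffq t w i = 0"
      by (auto simp: bdf2_kernel_def)
  qed (use assms in auto)
  then show ?thesis using assms by simp
qed

text \<open>
  Here \<open>s\<^sub>0, s\<^sub>1, s\<^sub>2\<close> stand for values of \<open>\<sigma>\<^sub>2\<close> or \<open>\<sigma>\<^sub>3\<close> at \<open>n, n - 1, n - 2\<close>, and the hypotheses on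
  them for the recursions \<open>a\<^sub>k \<sigma>\<^sup>k\<^sup>-\<^sup>1 \<le> \<sigma>\<^sup>k\<close> multiplied out.
\<close>

lemma dc4_real_bound:
  fixes h k l \<tau> R U s0 s1 s2 d0 d1 d2 :: real
  assumes pos: "h > 0" "k > 0" "l > 0" and le: "h \<le> \<tau>" "k \<le> \<tau>" "l \<le> \<tau>"
    and R: "1 \<le> R" "h \<le> R * k" and nonneg: "U \<ge> 0" "s0 \<ge> 0" "s1 \<ge> 0" "s2 \<ge> 0"
    and s1: "h * s1 \<le> (k + 2 * h) * s0" and s2: "k * s2 \<le> (l + 2 * k) * s1"
    and d: "\<bar>d0\<bar> \<le> U + s0" "\<bar>d1\<bar> \<le> U + s1" "\<bar>d2\<bar> \<le> U + s2"
  shows "\<bar>h / 3 * (d0 - d1) + h / 12 * (h + k) * (2 * h + k)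
            * ((d0 - d1) / (h + k) - (d1 - d2) / (k + l)) / (h + k + l)\<bar> \<le> 6 * R * \<tau> * (U + s0)"
proof -
  \<comment> \<open>These arise when the correction is written as a combination of
    \<open>d0 - d1\<close> and \<open>d1 - d2\<close>, with coefficients h/3 + h\<alpha>/12 and
    -h\<kappa>/12. Here \<alpha> is always at most 2, so \<kappa> can be large only through
    \<beta>.\<close>
  define \<alpha> where "\<alpha> = (2 * h + k) / (h + k + l)"
  define \<beta> where "\<beta> = (h + k) / (k + l)"
  define \<kappa> where "\<kappa> = \<alpha> * \<beta>"
  have \<alpha>: "0 \<le> \<alpha>" "\<alpha> \<le> 2" using pos by (auto simp: \<alpha>_def field_simps)
  have "h + k \<le> 2 * R * (k + l)"
  proof -
    have "k \<le> R * k" "0 \<le> R * l" using R pos by auto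
    then have "h + k \<le> 2 * (R * k) + 2 * (R * l)" using R by linarith
    then show ?thesis by (simp add: algebra_simps)
  qed
  then have \<beta>: "0 \<le> \<beta>" "\<beta> \<le> 2 * R" using pos by (auto simp: \<beta>_def field_simps)
  have \<kappa>: "0 \<le> \<kappa>" "\<kappa> \<le> 4 * R"
    using \<alpha> \<beta> mult_mono[OF \<alpha>(2) \<beta>(2)] R by (auto simp: \<kappa>_def)
  \<comment> \<open>This bound is free of \<open>R\<close>. It keeps the final estimate linear in
    \<open>R\<close>: shifting back by two indices produces the term (h/k) l, and estimating h/k and
    \<kappa> separately would give the square of \<open>R\<close>.\<close>
  have \<kappa>l: "\<kappa> * l \<le> 4 * \<tau>"
  proof -
    have "\<beta> * l \<le> h + k" using pos by (simp add: \<beta>_def field_simps)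
    then have "\<alpha> * (\<beta> * l) \<le> 2 * (h + k)"
      using \<alpha> \<beta> pos by (intro mult_mono) auto
    then show ?thesis using le by (simp add: \<kappa>_def mult.assoc)
  qed
  have \<tau>: "\<tau> > 0" using pos le by linarith
  have hU: "h * U \<le> \<tau> * U" using le nonneg by (simp add: mult_right_mono)
  have hs0: "h * s0 \<le> \<tau> * s0" using le nonneg by (simp add: mult_right_mono)
  have hs1: "h * s1 \<le> 3 * \<tau> * s0"
  proof -
    have "(k + 2 * h) * s0 \<le> (3 * \<tau>) * s0" using le nonneg by (intro mult_right_mono) auto
    then show ?thesis using s1 by linarith
  qed
  have \<kappa>U: "h * \<kappa> * U \<le> 4 * R * \<tau> * U"
  proof -
    have "\<kappa> * (h * U) \<le> (4 * R) * (\<tau> * U)"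
      using \<kappa> hU pos nonneg by (intro mult_mono[of \<kappa> _ "h * U"]) (auto intro: mult_nonneg_nonneg)
    then show ?thesis by (simp add: ac_simps)
  qed
  have \<kappa>1: "h * \<kappa> * s1 \<le> 12 * R * \<tau> * s0"
  proof -
    have "\<kappa> * (h * s1) \<le> (4 * R) * (3 * \<tau> * s0)"
      using \<kappa> hs1 pos nonneg by (intro mult_mono[of \<kappa> _ "h * s1"]) (auto intro: mult_nonneg_nonneg)
    then show ?thesis by (simp add: ac_simps)
  qed
  have \<kappa>2: "h * \<kappa> * s2 \<le> 36 * R * \<tau> * s0"
  proof -
    have hk: "h / k \<le> R" using R pos by (simp add: field_simps)
    have "s2 \<le> (l / k + 2) * s1" using s2 pos by (simp add: field_simps)
    then have "h * s2 \<le> h * ((l / k + 2) * s1)"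
      using pos by simp
    also have "\<dots> = (l / k + 2) * (h * s1)" by simp
    also have "\<dots> \<le> (l / k + 2) * ((k + 2 * h) * s0)"
      using s1 pos by (intro mult_left_mono) auto
    also have "\<dots> = (l + 2 * k + 4 * h + 2 * (h / k) * l) * s0"
      using pos by (simp add: field_simps)
    also have "\<dots> \<le> (7 * \<tau> + 2 * R * l) * s0"
    proof -
      have "(h / k) * l \<le> R * l" using hk pos by (intro mult_right_mono) auto
      then show ?thesis using le nonneg by (intro mult_right_mono) auto
    qed
    finally have "\<kappa> * (h * s2) \<le> \<kappa> * ((7 * \<tau> + 2 * R * l) * s0)"
      using \<kappa> by (intro mult_left_mono)
    also have "\<dots> = (7 * \<tau> * \<kappa> + 2 * R * (\<kappa> * l)) * s0" by (simp add: algebra_simps)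
    also have "\<dots> \<le> (7 * \<tau> * (4 * R) + 2 * R * (4 * \<tau>)) * s0"
      using \<kappa> \<kappa>l \<tau> R nonneg by (intro mult_right_mono add_mono mult_left_mono) auto
    finally show ?thesis by (simp add: algebra_simps)
  qed
  have split: "h / 3 * (d0 - d1) + h / 12 * (h + k) * (2 * h + k)
            * ((d0 - d1) / (h + k) - (d1 - d2) / (k + l)) / (h + k + l)
      = (h / 3 + h * \<alpha> / 12) * (d0 - d1) - h * \<kappa> / 12 * (d1 - d2)"
  proof -
    have "(h + k) * (((d0 - d1) / (h + k) - (d1 - d2) / (k + l)))
        = (d0 - d1) - \<beta> * (d1 - d2)"
      using pos by (subst right_diff_distrib) (simp add: \<beta>_def)
    then have *: "h / 12 * (h + k) * (2 * h + k)
            * ((d0 - d1) / (h + k) - (d1 - d2) / (k + l)) / (h + k + l)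
          = h / 12 * \<alpha> * ((d0 - d1) - \<beta> * (d1 - d2))"
      by (simp add: \<alpha>_def)
    show ?thesis unfolding * \<kappa>_def by (simp add: field_simps)
  qed
  have "\<bar>(h / 3 + h * \<alpha> / 12) * (d0 - d1) - h * \<kappa> / 12 * (d1 - d2)\<bar>
      \<le> \<bar>(h / 3 + h * \<alpha> / 12) * (d0 - d1)\<bar> + \<bar>h * \<kappa> / 12 * (d1 - d2)\<bar>"
    by (rule abs_triangle_ineq4)
  also have "\<dots> \<le> (h / 2) * (2 * U + s0 + s1) + h * \<kappa> / 12 * (2 * U + s1 + s2)"
  proof (rule add_mono)
    have "h * \<alpha> \<le> h * 2" using \<alpha> pos by (intro mult_left_mono) auto
    then have "h / 3 + h * \<alpha> / 12 \<le> h / 2" by linarith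
    moreover have "0 \<le> h / 3 + h * \<alpha> / 12" using \<alpha> pos by simp
    moreover have "\<bar>d0 - d1\<bar> \<le> 2 * U + s0 + s1" using d by linarith
    ultimately show "\<bar>(h / 3 + h * \<alpha> / 12) * (d0 - d1)\<bar> \<le> (h / 2) * (2 * U + s0 + s1)"
      unfolding abs_mult using nonneg pos by (intro mult_mono) auto
    have "\<bar>d1 - d2\<bar> \<le> 2 * U + s1 + s2" using d by linarith
    then show "\<bar>h * \<kappa> / 12 * (d1 - d2)\<bar> \<le> h * \<kappa> / 12 * (2 * U + s1 + s2)"
      using \<kappa> pos by (simp add: abs_mult mult_left_mono)
  qed
  also have "\<dots> = h * U + (h * s0 + h * s1) / 2 + (2 * (h * \<kappa> * U) + h * \<kappa> * s1 + h * \<kappa> * s2) / 12"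
    by (simp add: field_simps)
  also have "\<dots> \<le> \<tau> * U + (\<tau> * s0 + 3 * \<tau> * s0) / 2
      + (2 * (4 * R * \<tau> * U) + 12 * R * \<tau> * s0 + 36 * R * \<tau> * s0) / 12"
    by (intro add_mono divide_right_mono hU hs0 hs1 \<kappa>1 \<kappa>2 mult_left_mono[OF \<kappa>U]) auto
  also have "\<dots> \<le> 6 * R * \<tau> * (U + s0)"
  proof -
    have "\<tau> * U \<le> R * (\<tau> * U)" "\<tau> * s0 \<le> R * (\<tau> * s0)" "0 \<le> \<tau> * U"
      using mult_right_mono[OF R(1), of "\<tau> * U"] mult_right_mono[OF R(1), of "\<tau> * s0"] \<tau> nonneg
      by simp_all
    moreover have "\<tau> * U + (\<tau> * s0 + 3 * \<tau> * s0) / 2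
        + (2 * (4 * R * \<tau> * U) + 12 * R * \<tau> * s0 + 36 * R * \<tau> * s0) / 12
      = \<tau> * U + 2 * (\<tau> * s0) + 2 / 3 * (R * (\<tau> * U)) + 4 * (R * (\<tau> * s0))"
      by simp
    moreover have "6 * R * \<tau> * (U + s0) = 6 * (R * (\<tau> * U)) + 6 * (R * (\<tau> * s0))"
      by (simp add: algebra_simps)
    ultimately show ?thesis by linarith
  qed
  finally show ?thesis unfolding split .
qed

text \<open>Keeping the last term on the left makes the induction close: adding the next index costs
  twice the new term, and twice the recursion bounds this by the old last term plus twice the
  source.\<close>

lemma sum_half_rec:
  fixes x y :: "nat \<Rightarrow> real"
  assumes "s \<le> n" and rec: "\<And>k. s < k \<Longrightarrow> k \<le> n \<Longrightarrow> x k \<le> x (k - 1) / 2 + y k"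
  shows "(\<Sum>k\<in>{s+1..n}. x k) + x n \<le> x s + 2 * (\<Sum>k\<in>{s+1..n}. y k)"
  using assms
proof (induction n rule: dec_induct)
  case (step n)
  then show ?case using step.prems[of "Suc n"] step.IH by simp
qed simp

section \<open>Geometry of the mesh\<close>

locale mesh_on =
  fixes T :: real and N :: nat and t :: "nat \<Rightarrow> real"
  assumes mesh: "mesh T N t"
begin

abbreviation \<tau> where "\<tau> \<equiv> max_step N t"

lemma step_pos: "1 \<le> k \<Longrightarrow> k \<le> N \<Longrightarrow> step t k > 0"
  using mesh by (simp add: mesh_def step_def)

lemma step_le: "1 \<le> k \<Longrightarrow> k \<le> N \<Longrightarrow> step t k \<le> \<tau>"
  unfolding max_step_def by (rule Max_ge) auto

lemma ratio_pos: "2 \<le> k \<Longrightarrow> k \<le> N \<Longrightarrow> ratio t k > 0"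
  by (simp add: ratio_def step_pos)

lemma ratio_le: "2 \<le> k \<Longrightarrow> k \<le> N \<Longrightarrow> ratio t k \<le> max_ratio N t"
  unfolding max_ratio_def by (rule Max_ge) auto

lemma step_eq: "2 \<le> k \<Longrightarrow> k \<le> N \<Longrightarrow> step t k = ratio t k * step t (k - 1)"
  using step_pos[of "k - 1"] by (force simp: ratio_def)

lemma sum_step: "i \<le> j \<Longrightarrow> (\<Sum>k\<in>{i+1..j}. step t k) = t j - t i"
  by (induction j rule: dec_induct) (auto simp: step_def)

lemma t_mono: "i \<le> j \<Longrightarrow> j \<le> N \<Longrightarrow> t i \<le> t j"
proof -
  assume "i \<le> j" "j \<le> N"
  then have "0 \<le> (\<Sum>k\<in>{i+1..j}. step t k)"
    by (intro sum_nonneg) (auto intro: less_imp_le[OF step_pos])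
  then show ?thesis using sum_step[OF \<open>i \<le> j\<close>] by simp
qed

lemma t_less: "i < j \<Longrightarrow> j \<le> N \<Longrightarrow> t i < t j"
  using t_mono[of i "j - 1"] step_pos[of j] by (force simp: step_def)

lemma t_0: "t 0 = 0"
  using mesh by (simp add: mesh_def)

lemma t_N: "t N = T"
  using mesh by (simp add: mesh_def)

lemma t_range: "k \<le> N \<Longrightarrow> t k \<in> {0..T}"
  using t_mono[of 0 k] t_mono[of k N] t_0 t_N by simp

lemma max_step_le: "N \<ge> 1 \<Longrightarrow> \<tau> \<le> T"
  unfolding max_step_def
proof (rule Max.boundedI)
  fix a assume "a \<in> step t ` {1..N}"
  then obtain k where k: "1 \<le> k" "k \<le> N" "a = step t k" by auto
  then show "a \<le> T"
    using t_range[of k] t_range[of "k - 1"] by (fastforce simp: step_def)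
qed auto

lemma max_step_pos: "N \<ge> 1 \<Longrightarrow> \<tau> > 0"
  using step_pos[of N] step_le[of N] by simp

lemma step_sum2:
  assumes "2 \<le> n" shows "t n - t (n - 2) = step t n + step t (n - 1)"
proof -
  obtain m where "n = Suc (Suc m)"
    using assms by (metis add_2_eq_Suc le_Suc_ex)
  then show ?thesis by (simp add: step_def)
qed

lemma step_sum3:
  assumes "3 \<le> n" shows "t n - t (n - 3) = step t n + step t (n - 1) + step t (n - 2)"
proof -
  obtain m where "n = Suc (Suc (Suc m))"
    using assms by (metis add_2_eq_Suc add_Suc le_Suc_ex numeral_3_eq_3 numeral_2_eq_2)
  then show ?thesis by (simp add: step_def)
qed

section \<open>Damping factors, orthogonal kernels and the sigma sequences\<close>

lemma damping_pos: "2 \<le> k \<Longrightarrow> k \<le> N \<Longrightarrow> damping t k > 0"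
  using ratio_pos[of k] by (simp add: damping_def)

lemma damping_le: "2 \<le> k \<Longrightarrow> k \<le> N \<Longrightarrow> damping t k \<le> 1 / 2"
  using ratio_pos[of k] by (simp add: damping_def field_simps)

lemma one_minus_damping_eq:
  "2 \<le> k \<Longrightarrow> k \<le> N \<Longrightarrow> 1 - damping t k = (1 + ratio t k) / (1 + 2 * ratio t k)"
  using ratio_pos[of k] by (simp add: damping_def field_simps)

lemma inverse_kernel: "2 \<le> k \<Longrightarrow> k \<le> N \<Longrightarrow> 1 / bdf2_kernel t k 0 = 1 - damping t k"
  by (simp add: one_minus_damping_eq bdf2_kernel_def)

lemma damping_kernel_0: "2 \<le> k \<Longrightarrow> k \<le> N \<Longrightarrow> (1 - damping t k) * bdf2_kernel t k 0 = 1"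
  using ratio_pos[of k] by (simp add: one_minus_damping_eq bdf2_kernel_def)

lemma damping_kernel_1: "2 \<le> k \<Longrightarrow> k \<le> N \<Longrightarrow> (1 - damping t k) * bdf2_kernel t k 1 = - damping t k"
  using ratio_pos[of k] by (simp add: one_minus_damping_eq bdf2_kernel_def) (simp add: damping_def)

lemma kernel_bounds:
  assumes "2 \<le> k" "k \<le> N"
  shows "\<bar>bdf2_kernel t k 0\<bar> \<le> 2" "\<bar>bdf2_kernel t k 1\<bar> \<le> 1"
  using ratio_pos[OF assms] by (auto simp: bdf2_kernel_def field_simps abs_if)

lemma diffq_rec:
  assumes "2 \<le> n" "n \<le> N"
  shows "diffq t w n = damping t n * diffq t w (n - 1) + (1 - damping t n) * bdf2_op t w n"
proof -
  have "(1 - damping t n) * bdf2_op t w n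
    = ((1 - damping t n) * bdf2_kernel t n 0) * diffq t w n
      + ((1 - damping t n) * bdf2_kernel t n 1) * diffq t w (n - 1)"
    by (simp add: bdf2_op_two_terms[OF assms(1)] algebra_simps)
  then show ?thesis
    by (simp only: damping_kernel_0[OF assms] damping_kernel_1[OF assms])
qed

lemma doc_kernel_diag: "2 \<le> n \<Longrightarrow> n \<le> N \<Longrightarrow> doc_kernel t n n = 1 - damping t n"
  by (subst doc_kernel.simps) (simp add: inverse_kernel)

lemma doc_kernel_step:
  assumes "2 \<le> j" "j < n" "n \<le> N"
  shows "doc_kernel t n j = - (1 / bdf2_kernel t j 0) * (doc_kernel t n (j + 1) * bdf2_kernel t (j + 1) 1)"
proof -
  have "(\<Sum>i=j+1..n. doc_kernel t n i * bdf2_kernel t i (i - j))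
      = (\<Sum>i\<in>{j+1}. doc_kernel t n i * bdf2_kernel t i (i - j))"
    by (rule sum.mono_neutral_right) (use assms in \<open>auto simp: bdf2_kernel_def\<close>)
  then show ?thesis
    using assms by (subst doc_kernel.simps) simp
qed

text \<open>The BDF2 kernels have only two nonzero entries, so the defining recursion runs downwards
  in \<open>j\<close> and involves \<open>n\<close> only through its initial value. Both sides
  therefore satisfy the same recursion, and it suffices to compare them at
  \<open>j = n - 1\<close>.\<close>

lemma doc_kernel_rec:
  assumes "j < n" "2 \<le> j" "n \<le> N"
  shows "doc_kernel t n j = damping t n * doc_kernel t (n - 1) j"
proof -
  have "j \<le> n - 1" using assms by simp
  then show ?thesis using \<open>2 \<le> j\<close>
  proof (induction j rule: inc_induct)
    case base
    have n: "2 \<le> n" "Suc (n - 1) = n" using assms by auto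
    have "(1 - damping t n) * bdf2_kernel t n 1 = - damping t n"
      using n assms by (intro damping_kernel_1) auto
    then show ?case
      using assms base n doc_kernel_step[of "n - 1" n] doc_kernel_diag[of n] doc_kernel_diag[of "n - 1"]
      by (simp add: inverse_kernel) (simp add: algebra_simps)
  next
    case (step j)
    then show ?case
      using assms doc_kernel_step[of j n] doc_kernel_step[of j "n - 1"] by simp
  qed
qed

text \<open>Convolution with the orthogonal kernels inverts BDF2: it solves the recursion of the
  difference quotients with value 0 at index 1, where the sum is empty. This links
  \<open>sigma3\<close> and \<open>sigma4\<close> to the error recursion.\<close>

lemma doc_sum_rec:
  assumes "2 \<le> n" "n \<le> N"
  shows "(\<Sum>i=2..n. doc_kernel t n i * g i)
    = damping t n * (\<Sum>i=2..n - 1. doc_kernel t (n - 1) i * g i) + (1 - damping t n) * g n"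
proof -
  have "{2..n} = insert n {2..n - 1}" using assms by auto
  then have "(\<Sum>i=2..n. doc_kernel t n i * g i)
    = doc_kernel t n n * g n + (\<Sum>i=2..n - 1. doc_kernel t n i * g i)"
    using assms by simp
  also have "(\<Sum>i=2..n - 1. doc_kernel t n i * g i)
     = (\<Sum>i=2..n - 1. damping t n * doc_kernel t (n - 1) i * g i)"
    by (rule sum.cong) (use assms doc_kernel_rec in auto)
  finally show ?thesis
    using assms by (simp add: doc_kernel_diag sum_distrib_left mult.assoc)
qed

lemma sigma2_rec: "2 \<le> n \<Longrightarrow> sigma2 t n = damping t n * sigma2 t (n - 1)"
proof -
  assume "2 \<le> n"
  then have "{2..n} = insert n {2..n - 1}" by auto
  then show ?thesis using \<open>2 \<le> n\<close> by (simp add: sigma2_def damping_def)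
qed

lemma sigma3_rec:
  "2 \<le> n \<Longrightarrow> n \<le> N \<Longrightarrow> sigma3 t n = damping t n * sigma3 t (n - 1) + (1 - damping t n) * sigma2 t n"
  unfolding sigma3_def by (rule doc_sum_rec)

lemma sigma4_rec:
  "2 \<le> n \<Longrightarrow> n \<le> N \<Longrightarrow> sigma4 t n = damping t n * sigma4 t (n - 1) + (1 - damping t n) * sigma3 t n"
  unfolding sigma4_def by (rule doc_sum_rec)

text \<open>Index 1 lies below the range of the original definitions. The empty product and the
  empty sums supply exactly the initial values that the recursions require there.\<close>

lemma sigma_1: "sigma2 t 1 = 1" "sigma3 t 1 = 0" "sigma4 t 1 = 0"
  by (simp_all add: sigma2_def sigma3_def sigma4_def)

lemma one_minus_damping: "2 \<le> k \<Longrightarrow> k \<le> N \<Longrightarrow> 0 \<le> 1 - damping t k \<and> 1 - damping t k \<le> 1"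
  using damping_pos[of k] damping_le[of k] by simp

lemma sigma_nonneg:
  assumes "1 \<le> n" "n \<le> N"
  shows "sigma2 t n \<ge> 0" "sigma3 t n \<ge> 0" "sigma4 t n \<ge> 0"
proof -
  have "n \<le> N \<longrightarrow> sigma2 t n \<ge> 0 \<and> sigma3 t n \<ge> 0 \<and> sigma4 t n \<ge> 0"
    using assms(1)
  proof (induction n rule: dec_induct)
    case base
    then show ?case using sigma_1 by simp
  next
    case (step n)
    then show ?case
      using sigma2_rec[of "Suc n"] sigma3_rec[of "Suc n"] sigma4_rec[of "Suc n"]
        damping_pos[of "Suc n"] one_minus_damping[of "Suc n"] by auto
  qed
  then show "sigma2 t n \<ge> 0" "sigma3 t n \<ge> 0" "sigma4 t n \<ge> 0" using assms by auto
qed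

lemma sigma_damping_le:
  assumes "2 \<le> n" "n \<le> N"
  shows "damping t n * sigma2 t (n - 1) \<le> sigma2 t n" "damping t n * sigma3 t (n - 1) \<le> sigma3 t n"
  using sigma2_rec[of n] sigma3_rec[of n] sigma_nonneg[of n] one_minus_damping[of n] assms by auto

text \<open>\<open>sigma2\<close> starts from 1 with zero source, which gives 1. Each further
  sequence starts from 0 and has its predecessor as source, so \<open>sum_half_rec\<close> doubles
  the bound.\<close>

lemma sigma_sums:
  assumes "1 \<le> n" "n \<le> N"
  shows "(\<Sum>k\<in>{2..n}. sigma2 t k) \<le> 1" "(\<Sum>k\<in>{2..n}. sigma3 t k) \<le> 2"
    "(\<Sum>k\<in>{2..n}. sigma4 t k) \<le> 4"
proof -
  have dec: "damping t k * x \<le> x / 2" "(1 - damping t k) * x \<le> x"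
    if "2 \<le> k" "k \<le> N" "x \<ge> 0" for k x
    using mult_right_mono[OF damping_le[OF that(1,2)] that(3)] damping_pos[OF that(1,2)] that
    by (auto simp: algebra_simps)
  have "(\<Sum>k\<in>{1+1..n}. sigma2 t k) + sigma2 t n \<le> sigma2 t 1 + 2 * (\<Sum>k\<in>{1+1..n}. 0)"
  proof (rule sum_half_rec[OF assms(1)])
    fix k assume "1 < k" "k \<le> n"
    then show "sigma2 t k \<le> sigma2 t (k - 1) / 2 + 0"
      using sigma2_rec[of k] dec(1)[of k] sigma_nonneg[of "k - 1"] assms by simp
  qed
  then show 2: "(\<Sum>k\<in>{2..n}. sigma2 t k) \<le> 1"
    using sigma_1 sigma_nonneg[OF assms] by (simp add: numeral_2_eq_2)
  have "(\<Sum>k\<in>{1+1..n}. sigma3 t k) + sigma3 t n \<le> sigma3 t 1 + 2 * (\<Sum>k\<in>{1+1..n}. sigma2 t k)"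
  proof (rule sum_half_rec[OF assms(1)])
    fix k assume "1 < k" "k \<le> n"
    then show "sigma3 t k \<le> sigma3 t (k - 1) / 2 + sigma2 t k"
      using sigma3_rec[of k] dec(1)[of k "sigma3 t (k - 1)"] dec(2)[of k "sigma2 t k"]
        sigma_nonneg[of "k - 1"] sigma_nonneg[of k] assms by simp
  qed
  then show 3: "(\<Sum>k\<in>{2..n}. sigma3 t k) \<le> 2"
    using 2 sigma_1 sigma_nonneg[OF assms] by (simp add: numeral_2_eq_2)
  have "(\<Sum>k\<in>{1+1..n}. sigma4 t k) + sigma4 t n \<le> sigma4 t 1 + 2 * (\<Sum>k\<in>{1+1..n}. sigma3 t k)"
  proof (rule sum_half_rec[OF assms(1)])
    fix k assume "1 < k" "k \<le> n"
    then show "sigma4 t k \<le> sigma4 t (k - 1) / 2 + sigma3 t k"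
      using sigma4_rec[of k] dec(1)[of k "sigma4 t (k - 1)"] dec(2)[of k "sigma3 t k"]
        sigma_nonneg[of "k - 1"] sigma_nonneg[of k] assms by simp
  qed
  then show "(\<Sum>k\<in>{2..n}. sigma4 t k) \<le> 4"
    using 3 sigma_1 sigma_nonneg[OF assms] by (simp add: numeral_2_eq_2)
qed

section \<open>Corrections in terms of difference quotients\<close>

lemma corr23_eq:
  assumes "2 \<le> n" "n \<le> N"
  shows "corr23 f t w n = dc3 t (\<lambda>k. f (t k) (w k)) n"
proof -
  define D where "D = (\<lambda>k. diffq t (\<lambda>k. f (t k) (w k)) k)"
  have "divdiff t (\<lambda>k. f (t k) (w k)) 2 n = (D n - D (n - 1)) / (step t n + step t (n - 1))"
    unfolding step_sum2[OF assms(1), symmetric] D_def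
    by (simp add: numeral_2_eq_2 diffq_def step_def)
  \<comment> \<open>The bracket collapses to a product that cancels the denominator of the second
    divided difference.\<close>
  moreover have "ratio t n * (step t n + step t (n - 1))\<^sup>2 - (1 + ratio t n) * (step t n)\<^sup>2
      = step t n * (step t n + step t (n - 1))"
    unfolding step_eq[OF assms] by (simp add: power2_eq_square algebra_simps)
  moreover have "step t n + step t (n - 1) > 0"
    using assms step_pos[of "n - 1"] step_pos[of n] by force
  moreover have "corr23 f t w n = 1 / 3 * (ratio t n * (step t n + step t (n - 1))\<^sup>2
      - (1 + ratio t n) * (step t n)\<^sup>2) * divdiff t (\<lambda>k. f (t k) (w k)) 2 n"
    by (simp only: corr23_def)
  ultimately show ?thesis
    by (simp only: dc3_def D_def) (simp add: field_simps)
qed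

lemma corr24_eq:
  assumes "3 \<le> n" "n \<le> N"
  shows "corr24 f t w n = dc4 t (\<lambda>k. f (t k) (w k)) n"
proof -
  define y where "y = (\<lambda>k. f (t k) (w k))"
  have d2: "divdiff t y 2 k = (diffq t y k - diffq t y (k - 1)) / (step t k + step t (k - 1))"
    if "2 \<le> k" for k
    unfolding step_sum2[OF that, symmetric]
    by (simp add: numeral_2_eq_2 diffq_def step_def)
  have d2': "divdiff t y 2 (n - 1)
      = (diffq t y (n - 1) - diffq t y (n - 2)) / (step t (n - 1) + step t (n - 2))"
    using d2[of "n - 1"] assms by (simp add: numeral_2_eq_2 del: divdiff.simps)
  have "divdiff t y 3 n = (divdiff t y 2 n - divdiff t y 2 (n - 1)) / (t n - t (n - 3))"
    using divdiff.simps(2)[of t y 2 n] by (simp del: divdiff.simps)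
  also have "\<dots> = ((diffq t y n - diffq t y (n - 1)) / (step t n + step t (n - 1))
      - (diffq t y (n - 1) - diffq t y (n - 2)) / (step t (n - 1) + step t (n - 2)))
      / (step t n + step t (n - 1) + step t (n - 2))"
    unfolding step_sum3[OF assms(1)] d2' using assms by (subst d2) auto
  finally show ?thesis
    using assms corr23_eq[of n f w]
    by (simp add: corr24_def dc4_def y_def[symmetric] del: divdiff.simps)
qed

text \<open>\<open>U\<close> is the uniform part and \<open>S\<close> the damped part of the
  difference quotients. The condition on \<open>S\<close> bounds its previous value by its current
  one, at a cost that the step in front of the correction compensates. With \<open>S\<close> equal
  to 0 the lemma also estimates the correction of Taylor remainders.\<close>

lemma abs_dc3_le:
  assumes n: "2 \<le> n" "n \<le> N"
    and d: "\<And>j. j \<in> {n - 1..n} \<Longrightarrow> \<bar>diffq t y j\<bar> \<le> U + S j"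
    and U: "U \<ge> 0" and S: "S n \<ge> 0" "damping t n * S (n - 1) \<le> S n"
  shows "\<bar>dc3 t y n\<bar> \<le> 2 * \<tau> * (U + S n)"
proof -
  let ?h = "step t n" and ?k = "step t (n - 1)"
  have pos: "?h > 0" "?k > 0" and le: "?h \<le> \<tau>" "?k \<le> \<tau>"
    using n step_pos step_le by auto
  have "ratio t n * S (n - 1) \<le> (1 + 2 * ratio t n) * S n"
    using S ratio_pos[OF n] by (simp add: damping_def field_simps)
  then have "?h * S (n - 1) \<le> (?k + 2 * ?h) * S n"
    using mult_left_mono[of _ _ ?k] pos step_eq[OF n] by (fastforce simp: algebra_simps)
  moreover have "(?k + 2 * ?h) * S n \<le> (3 * \<tau>) * S n"
    using le S by (intro mult_right_mono) auto
  moreover have "?h * S n \<le> \<tau> * S n" "?h * U \<le> \<tau> * U"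
    using le S U by (auto intro: mult_right_mono)
  moreover have "\<bar>dc3 t y n\<bar> \<le> ?h / 3 * (2 * U + S n + S (n - 1))"
  proof -
    have "\<bar>diffq t y n - diffq t y (n - 1)\<bar> \<le> 2 * U + S n + S (n - 1)"
      using d[of n] d[of "n - 1"] by auto
    then show ?thesis using pos by (simp add: dc3_def abs_mult)
  qed
  moreover have "0 \<le> \<tau> * U" "0 \<le> \<tau> * S n"
    using pos le U S by auto
  ultimately show ?thesis by (simp add: algebra_simps)
qed

lemma abs_dc4_le:
  assumes n: "3 \<le> n" "n \<le> N"
    and d: "\<And>j. j \<in> {n - 2..n} \<Longrightarrow> \<bar>diffq t y j\<bar> \<le> U + S j"
    and U: "U \<ge> 0" and S: "\<And>j. j \<in> {n - 2..n} \<Longrightarrow> S j \<ge> 0"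
      "\<And>j. j \<in> {n - 1..n} \<Longrightarrow> damping t j * S (j - 1) \<le> S j"
  shows "\<bar>dc4 t y n\<bar> \<le> 6 * max 1 (max_ratio N t) * \<tau> * (U + S n)"
proof -
  have damp: "step t j * S (j - 1) \<le> (step t (j - 1) + 2 * step t j) * S j"
    if "j \<in> {n - 1..n}" for j
  proof -
    have j: "2 \<le> j" "j \<le> N" using that n by auto
    have "ratio t j * S (j - 1) \<le> (1 + 2 * ratio t j) * S j"
      using S(2)[OF that] ratio_pos[OF j] by (simp add: damping_def field_simps)
    then show ?thesis
      using mult_left_mono[of _ _ "step t (j - 1)"] step_pos[of "j - 1"] j step_eq[OF j]
      by (fastforce simp: algebra_simps)
  qed
  \<comment> \<open>Of the two step ratios formed by the three steps involved, only the most recent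
    one has to be bounded.\<close>
  have hk: "step t n \<le> max 1 (max_ratio N t) * step t (n - 1)"
    using step_eq[of n] ratio_le[of n] n step_pos[of "n - 1"] by (force intro: mult_right_mono)
  have n12: "n - 1 - 1 = n - 2" and mem: "n \<in> {n - 1..n}" "n - 1 \<in> {n - 1..n}"
    "n \<in> {n - 2..n}" "n - 1 \<in> {n - 2..n}" "n - 2 \<in> {n - 2..n}" and ge: "1 \<le> n" "1 \<le> n - 1" "1 \<le> n - 2"
    and le: "n - 1 \<le> N" "n - 2 \<le> N"
    using n by auto
  show ?thesis
    unfolding dc4_def dc3_def
    by (rule dc4_real_bound[OF step_pos[OF ge(1) n(2)] step_pos[OF ge(2) le(1)] step_pos[OF ge(3) le(2)]
          step_le[OF ge(1) n(2)] step_le[OF ge(2) le(1)] step_le[OF ge(3) le(2)] max.cobounded1 hk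
          U S(1)[OF mem(3)] S(1)[OF mem(4)] S(1)[OF mem(5)] damp[OF mem(1)] damp[OF mem(2), unfolded n12]
          d[OF mem(3)] d[OF mem(4)] d[OF mem(5)]])
qed

end

section \<open>Consistency and stability\<close>

lemma abs_triangle3_le:
  fixes x y z :: real
  assumes "\<bar>x\<bar> \<le> a" "\<bar>y\<bar> \<le> b" "\<bar>z\<bar> \<le> c"
  shows "\<bar>x + y + z\<bar> \<le> a + b + c"
  using assms by linarith

text \<open>The Gronwall factor of an implicit step, 1 / (1 - x) \<le> exp (2 x), used with x equal
  to the Lipschitz constant times the step. The step size restriction supplies the upper bound on
  x.\<close>

lemma one_le_exp_mult:
  fixes x :: real
  assumes "0 \<le> x" "x \<le> 1 / 4"
  shows "1 \<le> exp (2 * x) * (1 - x)"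
proof -
  have "x * x \<le> x * (1 / 4)" using assms by (intro mult_left_mono) auto
  then have "1 \<le> (1 + 2 * x) * (1 - x)" using assms by (simp add: algebra_simps)
  also have "\<dots> \<le> exp (2 * x) * (1 - x)"
    using assms by (intro mult_right_mono exp_ge_add_one_self) auto
  finally show ?thesis .
qed

context mesh_on
begin

section \<open>Truncation errors\<close>

lemma diffq_le:
  assumes "1 \<le> k" "k \<le> N" "\<bar>w k - w (k - 1)\<bar> \<le> b * step t k"
  shows "\<bar>diffq t w k\<bar> \<le> b"
  using assms step_pos[of k] by (simp add: diffq_def abs_div_pos[symmetric] divide_le_eq)

text \<open>The Newton form of BDF2: the derivative at \<open>t n\<close> of the quadratic
  interpolant through the last three nodes.\<close>

lemma bdf2_op_eq:
  assumes "2 \<le> n" "n \<le> N"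
  shows "bdf2_op t w n = diffq t w n
    + step t n / (step t n + step t (n - 1)) * (diffq t w n - diffq t w (n - 1))"
proof -
  have pos: "step t n > 0" "step t (n - 1) > 0" using assms by (auto intro: step_pos)
  define u where "u = step t n / (step t n + step t (n - 1))"
  have "ratio t n / (1 + ratio t n) = u"
    using pos by (simp add: u_def ratio_def field_simps)
  moreover have "(1 + 2 * ratio t n) / (1 + ratio t n) = 1 + ratio t n / (1 + ratio t n)"
    using ratio_pos[OF assms] by (simp add: field_simps)
  ultimately show ?thesis
    unfolding u_def[symmetric]
    by (simp add: bdf2_op_two_terms[OF assms(1)] bdf2_kernel_def right_diff_distrib distrib_right)
qed

lemma abs_bdf2_op_le:
  assumes n: "2 \<le> n" "n \<le> N" and d: "\<bar>diffq t w n\<bar> \<le> b" "\<bar>diffq t w (n - 1)\<bar> \<le> b"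
  shows "\<bar>bdf2_op t w n\<bar> \<le> 3 * b"
proof -
  have "\<bar>bdf2_op t w n\<bar> \<le> \<bar>bdf2_kernel t n 0 * diffq t w n\<bar> + \<bar>bdf2_kernel t n 1 * diffq t w (n - 1)\<bar>"
    unfolding bdf2_op_two_terms[OF n(1)] by (rule abs_triangle_ineq)
  also have "\<dots> \<le> 2 * b + 1 * b"
    unfolding abs_mult using kernel_bounds[OF n] d by (intro add_mono mult_mono) auto
  finally show ?thesis by simp
qed

text \<open>Relative to \<open>t n\<close> the nodes are 0, -h and -H. Quadratics are differentiated
  exactly. For x^3 and x^4 the interpolation error is x (x + h) (x + H) times 1 and x - h - H
  respectively; its derivative at 0, with the sign reversed, gives the two remaining terms.\<close>

lemma bdf2_op_quartic:
  assumes n: "2 \<le> n" "n \<le> N"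
  defines "h \<equiv> step t n" and "H \<equiv> step t n + step t (n - 1)"
  shows "bdf2_op t (\<lambda>k. a0 + a1 * (t k - t n) + a2 * (t k - t n)^2 + a3 * (t k - t n)^3
      + a4 * (t k - t n)^4) n = a1 - a3 * (h * H) + a4 * (h * H * (h + H))"
    (is "bdf2_op t ?Q n = _")
proof -
  have pos: "h > 0" "H > h" using n by (auto intro: step_pos simp: h_def H_def)
  have y: "t (n - 1) - t n = - h" "t (n - 2) - t n = - H"
    using step_sum2[OF n(1)] by (auto simp: h_def H_def step_def)
  have "?Q n - ?Q (n - 1) = h * (a1 - a2 * h + a3 * h^2 - a4 * h^3)"
    unfolding y by (simp add: power2_eq_square power3_eq_cube power4_eq_xxxx algebra_simps)
  then have d0: "diffq t ?Q n = a1 - a2 * h + a3 * h^2 - a4 * h^3"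
    using pos by (simp add: diffq_def h_def)
  have "?Q (n - 1) - ?Q (n - 2) = (H - h) * (a1 - a2 * (h + H) + a3 * (h^2 + h * H + H^2)
      - a4 * (h^3 + h^2 * H + h * H^2 + H^3))"
    unfolding y by (simp add: power2_eq_square power3_eq_cube power4_eq_xxxx algebra_simps)
  moreover have "step t (n - 1) = H - h" "n - 1 - 1 = n - 2" by (simp_all add: h_def H_def)
  ultimately have d1: "diffq t ?Q (n - 1) = a1 - a2 * (h + H) + a3 * (h^2 + h * H + H^2)
      - a4 * (h^3 + h^2 * H + h * H^2 + H^3)"
    using pos unfolding diffq_def by simp
  have "diffq t ?Q n - diffq t ?Q (n - 1)
      = H * (a2 - a3 * (h + H) + a4 * (h^2 + h * H + H^2))"
    unfolding d0 d1 by (simp add: power2_eq_square power3_eq_cube algebra_simps)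
  then have "bdf2_op t ?Q n = diffq t ?Q n + h * (a2 - a3 * (h + H) + a4 * (h^2 + h * H + H^2))"
    using pos unfolding bdf2_op_eq[OF n] H_def[symmetric] unfolding h_def[symmetric] by simp
  then show ?thesis
    unfolding d0 by (simp add: power2_eq_square power3_eq_cube algebra_simps)
qed

lemma diffq_cubic:
  assumes "1 \<le> k" "k \<le> N"
  shows "diffq t (\<lambda>k. a1 + a2 * (t k - c) + a3 * (t k - c)^2 + a4 * (t k - c)^3) k
    = a2 + a3 * ((t k - c) + (t (k - 1) - c))
      + a4 * ((t k - c)^2 + (t k - c) * (t (k - 1) - c) + (t (k - 1) - c)^2)"
proof -
  have eq: "(a1 + a2 * x + a3 * x^2 + a4 * x^3) - (a1 + a2 * y + a3 * y^2 + a4 * y^3)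
     = (x - y) * (a2 + a3 * (x + y) + a4 * (x^2 + x * y + y^2))" for x y :: real
    by (simp add: power2_eq_square power3_eq_cube algebra_simps)
  have "step t k = (t k - c) - (t (k - 1) - c)" by (simp add: step_def)
  then show ?thesis
    using step_pos[OF assms] unfolding diffq_def eq by simp
qed

text \<open>These values match the truncation error of BDF2 for the integrated polynomial, -a3/3 hH
  + a4/4 hH(h + H). Adding \<open>dc3\<close> removes the \<open>a3\<close> term and leaves -a4/12
  hH(h + H); adding \<open>dc4\<close> removes both, since its third divided difference of a cubic
  is exactly \<open>a4\<close>.\<close>

lemma dc_cubic:
  fixes a1 a2 a3 a4 :: real
  assumes n: "2 \<le> n" "n \<le> N"
  defines "h \<equiv> step t n" and "H \<equiv> step t n + step t (n - 1)"
    and "q \<equiv> \<lambda>k. a1 + a2 * (t k - t n) + a3 * (t k - t n)^2 + a4 * (t k - t n)^3"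
  shows "dc3 t q n = a3 / 3 * (h * H) - a4 / 3 * (h * H * (h + H))"
    and "3 \<le> n \<Longrightarrow> dc4 t q n = a3 / 3 * (h * H) - a4 / 4 * (h * H * (h + H))"
proof -
  have pos: "h > 0" "H > h" using n by (auto intro: step_pos simp: h_def H_def)
  have y: "t (n - 1) - t n = - h" "t (n - 2) - t n = - H"
    using step_sum2[OF n(1)] by (auto simp: h_def H_def step_def)
  have n1: "n - 1 - 1 = n - 2" by simp
  have d0: "diffq t q n = a2 - a3 * h + a4 * h^2"
    using diffq_cubic[of n a1 a2 "t n" a3 a4] n unfolding q_def y by simp
  have d1: "diffq t q (n - 1) = a2 - a3 * (h + H) + a4 * (h^2 + h * H + H^2)"
    using diffq_cubic[of "n - 1" a1 a2 "t n" a3 a4] n unfolding q_def n1 y by (simp add: algebra_simps)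
  have d01: "diffq t q n - diffq t q (n - 1) = H * (a3 - a4 * (h + H))"
    unfolding d0 d1 by (simp add: power2_eq_square algebra_simps)
  show dc3: "dc3 t q n = a3 / 3 * (h * H) - a4 / 3 * (h * H * (h + H))"
    unfolding dc3_def d01 h_def[symmetric] by (simp add: field_simps)
  assume n3: "3 \<le> n"
  define G where "G = H + step t (n - 2)"
  have G: "G > H" using n n3 by (auto intro: step_pos simp: G_def)
  have y3: "t (n - 3) - t n = - G" and n2: "n - 2 - 1 = n - 3"
    using step_sum3[OF n3] by (auto simp: G_def H_def)
  have d2: "diffq t q (n - 2) = a2 - a3 * (H + G) + a4 * (H^2 + H * G + G^2)"
    using diffq_cubic[of "n - 2" a1 a2 "t n" a3 a4] n n3 unfolding q_def n2 y y3 by (simp add: algebra_simps)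
  have d12: "diffq t q (n - 1) - diffq t q (n - 2) = (G - h) * (a3 - a4 * (h + H + G))"
    unfolding d1 d2 by (simp add: power2_eq_square algebra_simps)
  have s: "step t (n - 1) + step t (n - 2) = G - h" "step t n + step t (n - 1) + step t (n - 2) = G"
    "2 * step t n + step t (n - 1) = h + H"
    by (simp_all add: G_def H_def h_def)
  have "dc4 t q n = dc3 t q n + h / 12 * H * (h + H) * (a4 * G) / G"
  proof -
    have "H * (a3 - a4 * (h + H)) / H = a3 - a4 * (h + H)"
      "(G - h) * (a3 - a4 * (h + H + G)) / (G - h) = a3 - a4 * (h + H + G)"
      using pos G by simp_all
    then have "H * (a3 - a4 * (h + H)) / H - (G - h) * (a3 - a4 * (h + H + G)) / (G - h) = a4 * G"
      by (simp only:) (simp only: algebra_simps)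
    then show ?thesis
      unfolding dc4_def d01 d12 s unfolding H_def[symmetric] unfolding h_def[symmetric] by simp
  qed
  also have "\<dots> = a3 / 3 * (h * H) - a4 / 4 * (h * H * (h + H))"
    using pos G unfolding dc3 by (simp add: field_simps)
  finally show "dc4 t q n = a3 / 3 * (h * H) - a4 / 4 * (h * H * (h + H))" .
qed

text \<open>Expansion about \<open>t n\<close> leaves polynomial parts that are evaluated exactly,
  and remainders that are seen only through difference quotients. On the remainders BDF2 costs 48 =
  3 * 2^4, \<open>dc3\<close> costs 16 = 2 * 2^3 and \<open>dc4\<close> costs 162 = 6 * 3^3, whence
  64 = 48 + 16 and 210 = 48 + 162. Surplus powers of the step are lowered with \<tau> \<le>
  T.\<close>

lemma consistency:
  fixes f :: "real \<Rightarrow> real \<Rightarrow> real" and v :: "real \<Rightarrow> real"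
  assumes B: "B \<ge> 0"
    and taylor: "quartic_expansion f v T B"
    and n: "2 \<le> n" "n \<le> N"
  defines "V \<equiv> \<lambda>k. v (t k)" and "F \<equiv> \<lambda>k. f (t k) (v (t k))"
  shows "\<bar>bdf2_op t V n - F n\<bar> \<le> B * (1 + 2 * T + 48 * T^2) * \<tau>^2"
    and "\<bar>bdf2_op t V n + dc3 t F n - F n\<bar> \<le> B * (1 + 64 * T) * \<tau>^3"
    and "3 \<le> n \<Longrightarrow> \<bar>bdf2_op t V n + dc4 t F n - F n\<bar> \<le> 210 * B * max 1 (max_ratio N t) * \<tau>^4"
proof -
  have c: "t n \<in> {0<..T}" using t_less[of 0 n] t_0 t_range[of n] n by auto
  obtain a3 a4 a2 P \<rho> where a: "\<bar>a3\<bar> \<le> B" "\<bar>a4\<bar> \<le> B"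
    and F: "\<And>x. f x (v x) = f (t n) (v (t n)) + a2 * (x - t n) + a3 * (x - t n)^2
        + a4 * (x - t n)^3 + \<rho> x"
    and V: "\<And>x. v x = v (t n) + f (t n) (v (t n)) * (x - t n) + a2 / 2 * (x - t n)^2
        + a3 / 3 * (x - t n)^3 + a4 / 4 * (x - t n)^4 + P x"
    and rem: "\<And>x y. 0 \<le> x \<Longrightarrow> x < y \<Longrightarrow> y \<le> t n \<Longrightarrow>
        \<bar>P y - P x\<bar> \<le> B * (t n - x)^4 * (y - x) \<and> \<bar>\<rho> y - \<rho> x\<bar> \<le> B * (t n - x)^3 * (y - x)"
    using bspec[OF taylor[unfolded quartic_expansion_def] c] by blast
  define h where "h = step t n"
  define H where "H = step t n + step t (n - 1)"
  have h: "0 < h" "h \<le> \<tau>" and H: "0 < H" "H \<le> 2 * \<tau>"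
  proof -
    have "1 \<le> n" "1 \<le> n - 1" "n - 1 \<le> N" using n by auto
    then show "0 < h" "h \<le> \<tau>" "0 < H" "H \<le> 2 * \<tau>"
      using n step_pos[of n] step_pos[of "n - 1"] step_le[of n] step_le[of "n - 1"]
      unfolding h_def H_def by linarith+
  qed
  have \<tau>: "0 < \<tau>" "\<tau> \<le> T" using max_step_pos max_step_le n by auto
  define Q where "Q = (\<lambda>k. v (t n) + F n * (t k - t n) + a2 / 2 * (t k - t n)^2
      + a3 / 3 * (t k - t n)^3 + a4 / 4 * (t k - t n)^4)"
  define q where "q = (\<lambda>k. F n + a2 * (t k - t n) + a3 * (t k - t n)^2 + a4 * (t k - t n)^3)"
  have remP: "(\<lambda>k. V k - Q k) = (\<lambda>k. P (t k))"
  proof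
    show "V k - Q k = P (t k)" for k
      unfolding V_def Q_def F_def using V[of "t k"] by linarith
  qed
  have rem\<rho>: "(\<lambda>k. F k - q k) = (\<lambda>k. \<rho> (t k))"
  proof
    show "F k - q k = \<rho> (t k)" for k
      unfolding q_def F_def using F[of "t k"] by linarith
  qed
  \<comment> \<open>\<open>m\<close> bounds the distance from \<open>t n\<close> to the left end of
    the interval of index \<open>j\<close>: 2\<tau> for the three nodes of BDF2 and
    \<open>dc3\<close>, 3\<tau> for the four nodes of \<open>dc4\<close>.\<close>
  have dP: "\<bar>diffq t (\<lambda>k. P (t k)) j\<bar> \<le> B * m^4" and d\<rho>: "\<bar>diffq t (\<lambda>k. \<rho> (t k)) j\<bar> \<le> B * m^3"
    if j: "1 \<le> j" "j \<le> n" "t n - t (j - 1) \<le> m" for j m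
  proof -
    have jN: "j \<le> N" using j n by simp
    have pos: "step t j > 0" using j(1) jN by (rule step_pos)
    have ts: "0 \<le> t (j - 1)" "t (j - 1) < t j" "t j \<le> t n"
      using t_range[of "j - 1"] t_less[of "j - 1" j] t_mono[of j n] j n by auto
    have m: "(t n - t (j - 1))^i \<le> m^i" for i
      using j(3) ts(2,3) by (intro power_mono) linarith+
    have "B * (t n - t (j - 1))^4 * step t j \<le> B * m^4 * step t j"
      using m[of 4] B pos by (intro mult_right_mono mult_left_mono) auto
    then have "\<bar>P (t j) - P (t (j - 1))\<bar> \<le> B * m^4 * step t j"
      using rem[OF ts] unfolding step_def by linarith
    then show "\<bar>diffq t (\<lambda>k. P (t k)) j\<bar> \<le> B * m^4"
      by (rule diffq_le[OF j(1) jN])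
    have "B * (t n - t (j - 1))^3 * step t j \<le> B * m^3 * step t j"
      using m[of 3] B pos by (intro mult_right_mono mult_left_mono) auto
    then have "\<bar>\<rho> (t j) - \<rho> (t (j - 1))\<bar> \<le> B * m^3 * step t j"
      using rem[OF ts] unfolding step_def by linarith
    then show "\<bar>diffq t (\<lambda>k. \<rho> (t k)) j\<bar> \<le> B * m^3"
      by (rule diffq_le[OF j(1) jN])
  qed
  have gap2: "t n - t (j - 1) \<le> 2 * \<tau>" if "j \<in> {n - 1..n}" for j
  proof -
    have "t (n - 2) \<le> t (j - 1)" using that n by (intro t_mono) auto
    then show ?thesis using step_sum2[OF n(1)] H by (simp add: H_def)
  qed
  have op: "bdf2_op t V n = F n - a3 / 3 * (h * H) + a4 / 4 * (h * H * (h + H))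
      + bdf2_op t (\<lambda>k. P (t k)) n"
    using bdf2_op_quartic[OF n, of "v (t n)" "F n" "a2 / 2" "a3 / 3" "a4 / 4", folded Q_def h_def H_def]
      bdf2_op_diff[of t V Q n, unfolded remP] by linarith
  have opP: "\<bar>bdf2_op t (\<lambda>k. P (t k)) n\<bar> \<le> 48 * B * \<tau>^4"
  proof -
    have "\<bar>bdf2_op t (\<lambda>k. P (t k)) n\<bar> \<le> 3 * (B * (2 * \<tau>)^4)"
      using n by (intro abs_bdf2_op_le dP gap2) auto
    then show ?thesis by (simp add: power_mult_distrib)
  qed
  have hH: "\<bar>h * H\<bar> \<le> 2 * \<tau>^2" "\<bar>h * H * (h + H)\<bar> \<le> 6 * \<tau>^3"
  proof -
    have "h * H \<le> \<tau> * (2 * \<tau>)" using h H by (intro mult_mono) auto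
    then show 1: "\<bar>h * H\<bar> \<le> 2 * \<tau>^2" using h H by (simp add: power2_eq_square)
    have "\<bar>h * H * (h + H)\<bar> \<le> (2 * \<tau>^2) * (3 * \<tau>)"
      unfolding abs_mult[of "h * H"] using 1 h H by (intro mult_mono) auto
    then show "\<bar>h * H * (h + H)\<bar> \<le> 6 * \<tau>^3" by (simp add: power2_eq_square power3_eq_cube)
  qed
  have a3hH: "\<bar>a3 * (h * H)\<bar> \<le> 2 * B * \<tau>^2" and a4hH: "\<bar>a4 * (h * H * (h + H))\<bar> \<le> 6 * B * \<tau>^3"
    using mult_mono[OF a(1) hH(1)] mult_mono[OF a(2) hH(2)] B by (simp_all add: abs_mult)
  define \<alpha> where "\<alpha> = a3 * (h * H)"
  define \<beta> where "\<beta> = a4 * (h * H * (h + H))"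
  note a3hH = a3hH[folded \<alpha>_def] and a4hH = a4hH[folded \<beta>_def]
  have op: "bdf2_op t V n = F n - \<alpha> / 3 + \<beta> / 4 + bdf2_op t (\<lambda>k. P (t k)) n"
    using op by (simp add: \<alpha>_def \<beta>_def)
  have pow: "\<tau>^3 \<le> T * \<tau>^2" "\<tau>^4 \<le> T * \<tau>^3" "\<tau>^4 \<le> T^2 * \<tau>^2"
  proof -
    show "\<tau>^3 \<le> T * \<tau>^2" "\<tau>^4 \<le> T * \<tau>^3"
      using \<tau> mult_right_mono[of \<tau> T "\<tau>^2"] mult_right_mono[of \<tau> T "\<tau>^3"]
      by (simp_all add: power2_eq_square power3_eq_cube power4_eq_xxxx)
    have "\<tau>^2 * \<tau>^2 \<le> T^2 * \<tau>^2" using \<tau> by (intro mult_right_mono power_mono) auto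
    then show "\<tau>^4 \<le> T^2 * \<tau>^2" by (simp add: power2_eq_square power4_eq_xxxx)
  qed
  have Bpow: "B * \<tau>^3 \<le> B * (T * \<tau>^2)" "B * \<tau>^4 \<le> B * (T * \<tau>^3)" "B * \<tau>^4 \<le> B * (T^2 * \<tau>^2)"
    "0 \<le> B * \<tau>^2" "0 \<le> B * \<tau>^3" "0 \<le> B * \<tau>^4"
    using pow[THEN mult_left_mono[OF _ B]] B \<tau> by simp_all
  have "\<bar>- \<alpha> / 3 + \<beta> / 4 + bdf2_op t (\<lambda>k. P (t k)) n\<bar> \<le> B * \<tau>^2 + 2 * (B * \<tau>^3) + 48 * B * \<tau>^4"
    using opP a3hH a4hH Bpow(4,5) by (intro abs_triangle3_le) simp_all
  also have "- \<alpha> / 3 + \<beta> / 4 + bdf2_op t (\<lambda>k. P (t k)) n = bdf2_op t V n - F n"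
    unfolding op by simp
  also have "B * \<tau>^2 + 2 * (B * \<tau>^3) + 48 * B * \<tau>^4
      \<le> B * \<tau>^2 + 2 * (B * (T * \<tau>^2)) + 48 * (B * (T^2 * \<tau>^2))"
    using Bpow(1,3) by linarith
  also have "\<dots> = B * (1 + 2 * T + 48 * T^2) * \<tau>^2" by (simp add: algebra_simps)
  finally show "\<bar>bdf2_op t V n - F n\<bar> \<le> B * (1 + 2 * T + 48 * T^2) * \<tau>^2" .
  have "dc3 t F n = dc3 t q n + dc3 t (\<lambda>k. \<rho> (t k)) n"
    using dc3_diff[of t F q n, unfolded rem\<rho>] by simp
  then have dc3: "dc3 t F n = \<alpha> / 3 - \<beta> / 3 + dc3 t (\<lambda>k. \<rho> (t k)) n"
    using dc_cubic(1)[OF n, of "F n" a2 a3 a4, folded q_def h_def H_def] by (simp add: \<alpha>_def \<beta>_def)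
  have "\<bar>dc3 t (\<lambda>k. \<rho> (t k)) n\<bar> \<le> 2 * \<tau> * (B * (2 * \<tau>)^3 + 0)"
  proof (rule abs_dc3_le[OF n, where S = "\<lambda>_. 0"])
    fix j assume "j \<in> {n - 1..n}"
    moreover from this n have "1 \<le> j" "j \<le> n" by auto
    ultimately show "\<bar>diffq t (\<lambda>k. \<rho> (t k)) j\<bar> \<le> B * (2 * \<tau>)^3 + 0"
      using d\<rho>[OF _ _ gap2[of j]] by simp
  qed (use B \<tau> in auto)
  also have "\<dots> = 16 * B * \<tau>^4"
    by (simp add: power3_eq_cube power4_eq_xxxx)
  finally have "\<bar>dc3 t (\<lambda>k. \<rho> (t k)) n\<bar> \<le> 16 * B * \<tau>^4" .
  then have "\<bar>- \<beta> / 12 + bdf2_op t (\<lambda>k. P (t k)) n + dc3 t (\<lambda>k. \<rho> (t k)) n\<bar>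
      \<le> B * \<tau>^3 + 48 * B * \<tau>^4 + 16 * B * \<tau>^4"
    using opP a4hH Bpow(5) by (intro abs_triangle3_le) simp_all
  also have "- \<beta> / 12 + bdf2_op t (\<lambda>k. P (t k)) n + dc3 t (\<lambda>k. \<rho> (t k)) n
      = bdf2_op t V n + dc3 t F n - F n"
    unfolding op dc3 by simp
  also have "B * \<tau>^3 + 48 * B * \<tau>^4 + 16 * B * \<tau>^4 \<le> B * \<tau>^3 + 64 * (B * (T * \<tau>^3))"
    using Bpow(2) by linarith
  also have "\<dots> = B * (1 + 64 * T) * \<tau>^3" by (simp add: algebra_simps)
  finally show "\<bar>bdf2_op t V n + dc3 t F n - F n\<bar> \<le> B * (1 + 64 * T) * \<tau>^3" .
  assume n3: "3 \<le> n"
  have gap3: "t n - t (j - 1) \<le> 3 * \<tau>" if "j \<in> {n - 2..n}" for j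
  proof -
    have "t (n - 3) \<le> t (j - 1)" using that n n3 by (intro t_mono) auto
    moreover have "step t (n - 2) \<le> \<tau>" using n n3 by (intro step_le) auto
    ultimately show ?thesis using step_sum3[OF n3] H by (simp add: H_def)
  qed
  let ?R = "max 1 (max_ratio N t)"
  have "dc4 t F n = dc4 t q n + dc4 t (\<lambda>k. \<rho> (t k)) n"
    using dc4_diff[of t F q n, unfolded rem\<rho>] by simp
  then have dc4: "dc4 t F n = \<alpha> / 3 - \<beta> / 4 + dc4 t (\<lambda>k. \<rho> (t k)) n"
    using dc_cubic(2)[OF n n3, of "F n" a2 a3 a4, folded q_def h_def H_def] by (simp add: \<alpha>_def \<beta>_def)
  have "\<bar>dc4 t (\<lambda>k. \<rho> (t k)) n\<bar> \<le> 6 * ?R * \<tau> * (B * (3 * \<tau>)^3 + 0)"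
  proof (rule abs_dc4_le[OF n3 n(2), where S = "\<lambda>_. 0"])
    fix j assume "j \<in> {n - 2..n}"
    moreover from this n3 have "1 \<le> j" "j \<le> n" by auto
    ultimately show "\<bar>diffq t (\<lambda>k. \<rho> (t k)) j\<bar> \<le> B * (3 * \<tau>)^3 + 0"
      using d\<rho>[OF _ _ gap3[of j]] by simp
  qed (use B \<tau> in auto)
  also have "\<dots> = 162 * (?R * (B * \<tau>^4))"
    by (simp add: power3_eq_cube power4_eq_xxxx)
  finally have "\<bar>dc4 t (\<lambda>k. \<rho> (t k)) n\<bar> \<le> 162 * (?R * (B * \<tau>^4))" .
  moreover have "B * \<tau>^4 \<le> ?R * (B * \<tau>^4)"
    using mult_right_mono[of 1 ?R "B * \<tau>^4"] Bpow by simp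
  ultimately have "\<bar>0 + bdf2_op t (\<lambda>k. P (t k)) n + dc4 t (\<lambda>k. \<rho> (t k)) n\<bar>
      \<le> 0 + 48 * (?R * (B * \<tau>^4)) + 162 * (?R * (B * \<tau>^4))"
    using opP by (intro abs_triangle3_le) simp_all
  also have "0 + bdf2_op t (\<lambda>k. P (t k)) n + dc4 t (\<lambda>k. \<rho> (t k)) n = bdf2_op t V n + dc4 t F n - F n"
    unfolding op dc4 by simp
  also have "0 + 48 * (?R * (B * \<tau>^4)) + 162 * (?R * (B * \<tau>^4)) = 210 * (?R * (B * \<tau>^4))"
    by simp
  also have "\<dots> = 210 * B * ?R * \<tau>^4" by simp
  finally show "\<bar>bdf2_op t V n + dc4 t F n - F n\<bar> \<le> 210 * B * ?R * \<tau>^4" .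
qed

text \<open>The error and its difference quotient are bounded in one induction, since each estimate
  feeds the other. \<open>P\<close> has to satisfy its recursion only as an inequality, which leaves
  freedom in choosing the majorant. The start \<open>s\<close> is 1 for BDF2 and the third-order
  scheme and 2 for the fourth-order scheme.\<close>

lemma stability:
  assumes L: "L > 0" "L * \<tau> \<le> 1 / 4" and s: "1 \<le> s" and n: "n \<le> N" and A: "A \<ge> 0"
    and g: "\<And>k. s < k \<Longrightarrow> k \<le> n \<Longrightarrow> \<bar>bdf2_op t e k\<bar> \<le> L * \<bar>e k\<bar> + A + p k"
    and Ps: "\<bar>diffq t e s\<bar> \<le> P s"
    and P: "\<And>k. s < k \<Longrightarrow> k \<le> n \<Longrightarrow> damping t k * P (k - 1) + (1 - damping t k) * p k \<le> P k"
    and P0: "\<And>k. s \<le> k \<Longrightarrow> k \<le> n \<Longrightarrow> 0 \<le> P k"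
    and W: "(\<Sum>k\<in>{s+1..n}. P k) \<le> W"
    and k: "k \<in> {s..n}"
  defines "X \<equiv> exp (2 * L * T) * (\<bar>e s\<bar> + A * t n + \<tau> * W)"
  shows "\<bar>e k\<bar> \<le> X" and "\<bar>diffq t e k\<bar> \<le> L * X + A + P k"
proof -
  \<comment> \<open>The rate 2 L, instead of L, pays for the implicit factor 1 / (1 - L h) in every
    step.\<close>
  define Y where "Y = (\<lambda>k. exp (2 * L * t k) * (\<bar>e s\<bar> + (\<Sum>j\<in>{s+1..k}. step t j * (A + P j))))"
  have exp_ge: "exp (2 * L * t j) \<ge> 1" if "j \<le> N" for j
    using t_range[OF that] L by simp
  have claim: "k \<le> n \<longrightarrow> \<bar>e k\<bar> \<le> Y k \<and> \<bar>diffq t e k\<bar> \<le> L * Y k + A + P k" if "s \<le> k" for k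
    using that
  proof (induction k rule: dec_induct)
    case base
    show ?case
    proof
      assume "s \<le> n"
      then have "1 * \<bar>e s\<bar> \<le> Y s" using exp_ge[of s] n unfolding Y_def by (intro mult_mono) auto
      moreover have "0 \<le> L * Y s" using L unfolding Y_def by simp
      ultimately show "\<bar>e s\<bar> \<le> Y s \<and> \<bar>diffq t e s\<bar> \<le> L * Y s + A + P s"
        using Ps A by simp
    qed
  next
    case (step k)
    show ?case
    proof
      assume m: "Suc k \<le> n"
      define m where "m = Suc k"
      define h where "h = step t m"
      define a where "a = damping t m"
      have IH: "\<bar>e k\<bar> \<le> Y k" "\<bar>diffq t e k\<bar> \<le> L * Y k + A + P k"
        using step.IH m by auto
      have mN: "2 \<le> m" "m \<le> N" "s < m" "m \<le> n" "m - 1 = k" using m s step.hyps n by (auto simp: m_def)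
      have h: "0 < h" "h \<le> \<tau>" using mN by (auto simp: h_def intro: step_pos step_le)
      have Lh: "0 < L * h" "L * h \<le> 1 / 4"
        using L h order_trans[OF mult_left_mono[OF h(2) less_imp_le[OF L(1)]] L(2)] by simp_all
      have a: "0 \<le> a" "a \<le> 1"
        using damping_pos[of m] damping_le[of m] mN by (auto simp: a_def)
      have AP: "0 \<le> A + P m" using A P0 mN by simp
      have Yk0: "0 \<le> Y k" using IH by linarith
      have tm: "t m = t k + h" by (simp add: h_def step_def m_def)
      have "{s+1..m} = insert m {s+1..k}" using step.hyps by (auto simp: m_def)
      then have "(\<Sum>j\<in>{s+1..m}. step t j * (A + P j)) = (\<Sum>j\<in>{s+1..k}. step t j * (A + P j)) + h * (A + P m)"
        by (simp add: m_def h_def)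
      moreover have "exp (2 * L * t m) = exp (2 * (L * h)) * exp (2 * L * t k)"
        by (simp add: tm algebra_simps flip: exp_add)
      ultimately have "Y m = exp (2 * (L * h)) * (Y k + exp (2 * L * t k) * (h * (A + P m)))"
        by (simp only: Y_def) (simp only: algebra_simps)
      moreover have "1 * (h * (A + P m)) \<le> exp (2 * L * t k) * (h * (A + P m))"
        using exp_ge[of k] mN h AP by (intro mult_right_mono) auto
      ultimately have Ym: "exp (2 * (L * h)) * (Y k + h * (A + P m)) \<le> Y m"
        by simp
      have ex: "1 \<le> exp (2 * (L * h)) * (1 - L * h)"
        using Lh by (intro one_le_exp_mult) auto
      have YP: "0 \<le> Y k + h * (A + P m)" using Yk0 h AP by simp
      have "1 * (Y k + h * (A + P m)) \<le> (exp (2 * (L * h)) * (1 - L * h)) * (Y k + h * (A + P m))"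
        by (rule mult_right_mono[OF ex YP])
      also have "\<dots> = (1 - L * h) * (exp (2 * (L * h)) * (Y k + h * (A + P m)))" by simp
      also have "\<dots> \<le> (1 - L * h) * Y m" using Ym Lh by (intro mult_left_mono) auto
      finally have Ym': "Y k + h * (A + P m) \<le> (1 - L * h) * Y m" by simp
      have YkYm: "Y k \<le> Y m"
      proof -
        have "0 \<le> (1 - L * h) * Y m" using Ym' YP by linarith
        then have "0 \<le> Y m" using Lh by (simp add: zero_le_mult_iff)
        then have "0 \<le> (L * h) * Y m" using Lh by simp
        then have "(1 - L * h) * Y m \<le> Y m" by (simp add: algebra_simps)
        moreover have "0 \<le> h * (A + P m)" using h AP by simp
        ultimately show ?thesis using Ym' by linarith
      qed
      \<comment> \<open>The source contains the unknown error at \<open>m\<close> itself, so the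
        difference quotient is first bounded with the maximum \<mu>. If the new error exceeds
        \<open>Y k\<close>, it equals \<mu> in absolute value, can be moved to the left with factor
        1 - L h, and \<open>Ym'\<close> finishes the step.\<close>
      define \<mu> where "\<mu> = max (Y k) \<bar>e m\<bar>"
      have z: "\<bar>diffq t e m\<bar> \<le> L * \<mu> + A + P m"
      proof -
        have "diffq t e m = a * diffq t e k + (1 - a) * bdf2_op t e m"
          using diffq_rec[of m e] mN by (simp add: a_def)
        then have "\<bar>diffq t e m\<bar> \<le> \<bar>a * diffq t e k\<bar> + \<bar>(1 - a) * bdf2_op t e m\<bar>"
          by simp
        also have "\<dots> = a * \<bar>diffq t e k\<bar> + (1 - a) * \<bar>bdf2_op t e m\<bar>"
          using a by (simp add: abs_mult)
        also have "\<dots> \<le> a * (L * \<mu> + A + P k) + (1 - a) * (L * \<mu> + A + p m)"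
        proof (intro add_mono mult_left_mono)
          have "L * Y k \<le> L * \<mu>" "L * \<bar>e m\<bar> \<le> L * \<mu>"
            using L by (auto simp: \<mu>_def)
          then show "\<bar>diffq t e k\<bar> \<le> L * \<mu> + A + P k" "\<bar>bdf2_op t e m\<bar> \<le> L * \<mu> + A + p m"
            using IH g[of m] mN by auto
        qed (use a in auto)
        also have "\<dots> = L * \<mu> + A + (a * P k + (1 - a) * p m)" by (simp add: algebra_simps)
        also have "\<dots> \<le> L * \<mu> + A + P m" using P[of m] mN by (simp add: a_def)
        finally show ?thesis .
      qed
      have em: "\<bar>e m\<bar> \<le> \<bar>e k\<bar> + h * \<bar>diffq t e m\<bar>"
      proof -
        have "e m = e k + h * diffq t e m" using h mN by (simp add: diffq_def h_def)
        then have "\<bar>e m\<bar> \<le> \<bar>e k\<bar> + \<bar>h * diffq t e m\<bar>" by (metis abs_triangle_ineq)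
        then show ?thesis using h by (simp add: abs_mult)
      qed
      have eY: "\<bar>e m\<bar> \<le> Y m"
      proof (cases "\<bar>e m\<bar> \<le> Y k")
        case True
        then show ?thesis using YkYm by linarith
      next
        case False
        then have \<mu>: "\<mu> = \<bar>e m\<bar>" by (simp add: \<mu>_def)
        have "h * \<bar>diffq t e m\<bar> \<le> h * (L * \<bar>e m\<bar> + A + P m)"
          using z h unfolding \<mu> by (intro mult_left_mono) auto
        then have "(1 - L * h) * \<bar>e m\<bar> \<le> Y k + h * (A + P m)"
          using em IH by (simp add: algebra_simps)
        then have "(1 - L * h) * \<bar>e m\<bar> \<le> (1 - L * h) * Y m" using Ym' by linarith
        then show ?thesis using Lh by simp
      qed
      moreover have "L * \<mu> \<le> L * Y m" using L eY YkYm by (simp add: \<mu>_def)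
      ultimately show "\<bar>e (Suc k)\<bar> \<le> Y (Suc k) \<and> \<bar>diffq t e (Suc k)\<bar> \<le> L * Y (Suc k) + A + P (Suc k)"
        using z unfolding m_def by simp
    qed
  qed
  \<comment> \<open>The next correction needs one bound for all indices up to \<open>n\<close>, so
    the dependence on \<open>k\<close> is given up. The steps still sum to at most
    \<open>t n\<close>, and the damped part yields only \<tau> times \<open>W\<close>.\<close>
  have YX: "Y k \<le> X"
    unfolding Y_def X_def
  proof (rule mult_mono)
    show "exp (2 * L * t k) \<le> exp (2 * L * T)"
      using t_range[of k] k n L by simp
    have "(\<Sum>j\<in>{s+1..k}. step t j * (A + P j)) \<le> (\<Sum>j\<in>{s+1..n}. step t j * (A + P j))"
      using k A P0 n s by (intro sum_mono2) (auto intro!: mult_nonneg_nonneg add_nonneg_nonneg less_imp_le[OF step_pos])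
    also have "\<dots> = A * (\<Sum>j\<in>{s+1..n}. step t j) + (\<Sum>j\<in>{s+1..n}. step t j * P j)"
      by (simp add: distrib_left sum.distrib sum_distrib_left mult.commute)
    also have "\<dots> \<le> A * t n + \<tau> * W"
    proof (rule add_mono)
      have "(\<Sum>j\<in>{s+1..n}. step t j) \<le> t n"
        using sum_step[of s n] t_range[of s] k n by auto
      then show "A * (\<Sum>j\<in>{s+1..n}. step t j) \<le> A * t n" using A by (rule mult_left_mono)
      have "(\<Sum>j\<in>{s+1..n}. step t j * P j) \<le> (\<Sum>j\<in>{s+1..n}. \<tau> * P j)"
        using P0 n s by (intro sum_mono mult_right_mono step_le) auto
      also have "\<dots> = \<tau> * (\<Sum>j\<in>{s+1..n}. P j)" by (simp add: sum_distrib_left)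
      also have "\<dots> \<le> \<tau> * W" using W max_step_pos n s k by (intro mult_left_mono) auto
      finally show "(\<Sum>j\<in>{s+1..n}. step t j * P j) \<le> \<tau> * W" .
    qed
    finally show "\<bar>e s\<bar> + (\<Sum>j\<in>{s+1..k}. step t j * (A + P j)) \<le> \<bar>e s\<bar> + A * t n + \<tau> * W"
      by simp
    show "0 \<le> \<bar>e s\<bar> + (\<Sum>j\<in>{s+1..k}. step t j * (A + P j))"
      using k A P0 n s by (intro add_nonneg_nonneg sum_nonneg)
        (auto intro!: mult_nonneg_nonneg add_nonneg_nonneg less_imp_le[OF step_pos])
  qed simp
  then show "\<bar>e k\<bar> \<le> X" "\<bar>diffq t e k\<bar> \<le> L * X + A + P k"
    using claim[of k] k mult_left_mono[OF YX less_imp_le[OF L(1)]] by simp_all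
qed

subsection \<open>Error of the three schemes\<close>

lemma err_eq: "w 0 = v 0 \<Longrightarrow> err v t w = (\<lambda>k. v (t k) - w k)"
  by (auto simp: err_def fun_eq_iff t_0)

text \<open>Subtracting the scheme from the perturbed equation of the exact solution leaves a
  Lipschitz difference, the truncation error and the effect of correcting with erroneous data. Here
  \<open>c'\<close> belongs to the exact data and \<open>c\<close> to the computed data; both are 0
  for BDF2.\<close>

lemma scheme_error_step:
  assumes lip: "\<forall>s\<in>{0..T}. L-lipschitz_on UNIV (f s)" and n: "n \<le> N"
    and scheme: "bdf2_op t w n + c = f (t n) (w n)"
    and cons: "\<bar>bdf2_op t (\<lambda>k. v (t k)) n + c' - f (t n) (v (t n))\<bar> \<le> A"
    and corr: "\<bar>c' - c\<bar> \<le> b"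
  shows "\<bar>bdf2_op t (\<lambda>k. v (t k) - w k) n\<bar> \<le> L * \<bar>v (t n) - w n\<bar> + A + b"
proof -
  have "\<bar>f (t n) (v (t n)) - f (t n) (w n)\<bar> \<le> L * \<bar>v (t n) - w n\<bar>"
    using lipschitz_onD[OF bspec[OF lip t_range[OF n]], of "v (t n)" "w n"]
    by (simp add: dist_real_def)
  moreover have "bdf2_op t (\<lambda>k. v (t k) - w k) n
    = (f (t n) (v (t n)) - f (t n) (w n)) + (bdf2_op t (\<lambda>k. v (t k)) n + c' - f (t n) (v (t n)))
      + - (c' - c)"
    using scheme by (simp add: bdf2_op_diff)
  moreover have "\<bar>- (c' - c)\<bar> \<le> b"
    unfolding abs_minus_cancel by (rule corr)
  ultimately show ?thesis
    using cons by (simp only: abs_triangle3_le)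
qed

text \<open>The mixed difference bound is applied to two consecutive errors, whose difference is a
  step times the difference quotient. \<open>X \<le> D\<close> is the a priori bound that keeps them
  in its range. The damped part \<open>S\<close> is passed on with factor \<open>Q\<close>, separate
  from the uniform part.\<close>

lemma diffq_rhs_difference_le:
  assumes Q: "Q \<ge> 0" and mixed: "mixed_difference_bound f v T D Q"
    and k: "1 \<le> k" "k \<le> N" and XD: "X \<le> D"
    and e: "\<bar>v (t k) - w k\<bar> \<le> X" "\<bar>v (t (k - 1)) - w (k - 1)\<bar> \<le> X"
    and de: "\<bar>diffq t (\<lambda>k. v (t k) - w k) k\<bar> \<le> L * X + A + S"
  shows "\<bar>diffq t (\<lambda>k. f (t k) (v (t k)) - f (t k) (w k)) k\<bar> \<le> Q * ((2 + L) * X + A) + Q * S"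
proof -
  define e1 where "e1 = v (t k) - w k"
  define e0 where "e0 = v (t (k - 1)) - w (k - 1)"
  have ts: "t (k - 1) \<in> {0..T}" "t k \<in> {0..T}" using t_range[of k] t_range[of "k - 1"] k by auto
  have pos: "step t k > 0" using step_pos k by simp
  have ab: "\<bar>t k - t (k - 1)\<bar> = step t k" using pos by (simp add: step_def)
  have "\<bar>e0\<bar> \<le> D" "\<bar>e1\<bar> \<le> D" using e XD by (auto simp: e0_def e1_def)
  then have "\<bar>(f (t k) (v (t k)) - f (t k) (v (t k) - e1))
      - (f (t (k - 1)) (v (t (k - 1))) - f (t (k - 1)) (v (t (k - 1)) - e0))\<bar>
      \<le> Q * ((\<bar>e0\<bar> + \<bar>e1\<bar>) * step t k + \<bar>e1 - e0\<bar>)"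
    using mixed[unfolded mixed_difference_bound_def] ts unfolding ab[symmetric] by blast
  also have "\<dots> \<le> Q * ((X + X) * step t k + (L * X + A + S) * step t k)"
  proof (intro mult_left_mono add_mono mult_right_mono Q)
    have "e1 - e0 = diffq t (\<lambda>k. v (t k) - w k) k * step t k"
      using pos by (simp add: diffq_def e0_def e1_def)
    then show "\<bar>e1 - e0\<bar> \<le> (L * X + A + S) * step t k"
      using de pos by (simp add: abs_mult)
  qed (use e pos in \<open>auto simp: e0_def e1_def\<close>)
  also have "\<dots> = (Q * ((2 + L) * X + A) + Q * S) * step t k" by (simp add: algebra_simps)
  finally show ?thesis
    by (intro diffq_le k) (simp add: e0_def e1_def)
qed

text \<open>The truncation error is a uniform source, so the only damped part comes from the initial
  difference quotient: \<open>Z * sigma2\<close> solves the homogeneous recursion with value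
  \<open>Z\<close> at index 1.\<close>

lemma bdf2_error:
  fixes v :: "real \<Rightarrow> real"
  defines "e \<equiv> \<lambda>w k. v (t k) - w k"
  assumes L: "L > 0" "L * \<tau> \<le> 1 / 4" and lip: "\<forall>s\<in>{0..T}. L-lipschitz_on UNIV (f s)"
    and n: "n \<le> N" and A: "A \<ge> 0"
    and scheme: "\<forall>k\<in>{2..n}. bdf2_op t w k = f (t k) (w k)"
    and cons: "\<forall>k\<in>{2..n}. \<bar>bdf2_op t (\<lambda>k. v (t k)) k - f (t k) (v (t k))\<bar> \<le> A"
    and k: "k \<in> {1..n}"
  defines "Z \<equiv> \<bar>diffq t (e w) 1\<bar>"
  defines "X \<equiv> exp (2 * L * T) * (\<bar>e w 1\<bar> + A * t n + \<tau> * Z)"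
  shows "\<bar>e w k\<bar> \<le> X" and "\<bar>diffq t (e w) k\<bar> \<le> L * X + A + Z * sigma2 t k"
proof -
  have g: "\<bar>bdf2_op t (e w) k\<bar> \<le> L * \<bar>e w k\<bar> + A + 0" if "1 < k" "k \<le> n" for k
    unfolding e_def
    by (rule scheme_error_step[OF lip, where c = 0 and c' = 0]) (use that n scheme cons in auto)
  have W: "(\<Sum>k\<in>{1+1..n}. Z * sigma2 t k) \<le> Z"
    using mult_left_mono[OF sigma_sums(1)[of n], of Z] k n
    by (simp add: Z_def sum_distrib_left numeral_2_eq_2)
  define P where "P = (\<lambda>k. Z * sigma2 t k)"
  have P: "damping t k * P (k - 1) + (1 - damping t k) * 0 \<le> P k" if "1 < k" "k \<le> n" for k
    using sigma2_rec[of k] that by (simp add: P_def)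
  have P0: "P k \<ge> 0" if "1 \<le> k" "k \<le> n" for k
    using sigma_nonneg[of k] that n by (simp add: P_def Z_def)
  have P1: "\<bar>diffq t (e w) 1\<bar> \<le> P 1" by (simp add: P_def Z_def sigma_1[simplified])
  show "\<bar>e w k\<bar> \<le> X" "\<bar>diffq t (e w) k\<bar> \<le> L * X + A + Z * sigma2 t k"
    using stability[OF L order_refl n A g P1 P P0 W[folded P_def] k] by (simp_all add: X_def P_def)
qed

text \<open>The damped part of the data error enters as a source proportional to
  \<open>sigma2\<close>, and the recursion of \<open>sigma3\<close> describes the response. It
  vanishes at index 1, so the initial value stays with \<open>Z * sigma2\<close>. The uniform part
  joins the truncation error in \<open>A'\<close>. The coefficient 4 is 2 from
  \<open>abs_dc3_le\<close> times the bound 2 for the sum of \<open>sigma3\<close>.\<close>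

lemma dc3_error:
  fixes v :: "real \<Rightarrow> real"
  defines "e \<equiv> \<lambda>w k. v (t k) - w k"
  assumes L: "L > 0" "L * \<tau> \<le> 1 / 4" and lip: "\<forall>s\<in>{0..T}. L-lipschitz_on UNIV (f s)"
    and n: "n \<le> N" and A: "A \<ge> 0" and U: "U \<ge> 0" and b: "b \<ge> 0"
    and scheme: "\<forall>k\<in>{2..n}. bdf2_op t w k + corr23 f t w' k = f (t k) (w k)"
    and cons: "\<forall>k\<in>{2..n}. \<bar>bdf2_op t (\<lambda>k. v (t k)) k + dc3 t (\<lambda>k. f (t k) (v (t k))) k
        - f (t k) (v (t k))\<bar> \<le> A"
    and \<delta>: "\<forall>k\<in>{1..n}. \<bar>diffq t (\<lambda>k. f (t k) (v (t k)) - f (t k) (w' k)) k\<bar> \<le> U + b * sigma2 t k"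
    and k: "k \<in> {1..n}"
  defines "Z \<equiv> \<bar>diffq t (e w) 1\<bar>" and "A' \<equiv> A + 2 * \<tau> * U"
  defines "X \<equiv> exp (2 * L * T) * (\<bar>e w 1\<bar> + A' * t n + \<tau> * (Z + 4 * \<tau> * b))"
  shows "\<bar>e w k\<bar> \<le> X"
    and "\<bar>diffq t (e w) k\<bar> \<le> L * X + A' + (Z * sigma2 t k + 2 * \<tau> * b * sigma3 t k)"
proof -
  have \<tau>: "\<tau> \<ge> 0" using max_step_pos k n by force
  have g: "\<bar>bdf2_op t (e w) k\<bar> \<le> L * \<bar>e w k\<bar> + A' + 2 * \<tau> * b * sigma2 t k" if kn: "1 < k" "k \<le> n" for k
  proof -
    have k: "2 \<le> k" "k \<le> N" and mem: "k \<in> {2..n}" using kn n by auto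
    have "\<bar>dc3 t (\<lambda>k. f (t k) (v (t k)) - f (t k) (w' k)) k\<bar> \<le> 2 * \<tau> * (U + b * sigma2 t k)"
    proof (rule abs_dc3_le[OF k, where S = "\<lambda>k. b * sigma2 t k"])
      show "\<bar>diffq t (\<lambda>k. f (t k) (v (t k)) - f (t k) (w' k)) j\<bar> \<le> U + b * sigma2 t j"
        if "j \<in> {k - 1..k}" for j
        by (rule bspec[OF \<delta>]) (use that kn in auto)
      show "damping t k * (b * sigma2 t (k - 1)) \<le> b * sigma2 t k"
        using mult_left_mono[OF sigma_damping_le(1)[OF k] b] by (simp add: ac_simps)
    qed (use U b k sigma_nonneg in auto)
    then have "\<bar>bdf2_op t (e w) k\<bar> \<le> L * \<bar>e w k\<bar> + A + 2 * \<tau> * (U + b * sigma2 t k)"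
      unfolding e_def
      by (intro scheme_error_step[OF lip k(2), where c = "corr23 f t w' k"
            and c' = "dc3 t (\<lambda>k. f (t k) (v (t k))) k"])
        (use bspec[OF scheme mem] bspec[OF cons mem] corr23_eq[OF k, of f w'] in \<open>auto simp: dc3_diff\<close>)
    then show ?thesis by (simp add: A'_def algebra_simps)
  qed
  define P where "P = (\<lambda>k. Z * sigma2 t k + 2 * \<tau> * b * sigma3 t k)"
  have W: "(\<Sum>k\<in>{1+1..n}. P k) \<le> Z + 4 * \<tau> * b"
  proof -
    have n1: "1 \<le> n" using k by simp
    have "(\<Sum>k\<in>{1+1..n}. P k) = Z * (\<Sum>k\<in>{2..n}. sigma2 t k) + 2 * \<tau> * b * (\<Sum>k\<in>{2..n}. sigma3 t k)"
      by (simp add: P_def sum.distrib sum_distrib_left numeral_2_eq_2)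
    also have "\<dots> \<le> Z * 1 + 2 * \<tau> * b * 2"
      using \<tau> b sigma_sums[OF n1 n] by (intro add_mono mult_left_mono) (auto simp: Z_def)
    finally show ?thesis by simp
  qed
  have P: "damping t k * P (k - 1) + (1 - damping t k) * (2 * \<tau> * b * sigma2 t k) \<le> P k"
    if "1 < k" "k \<le> n" for k
  proof -
    have k: "2 \<le> k" "k \<le> N" using that n by auto
    have "damping t k * P (k - 1) + (1 - damping t k) * (2 * \<tau> * b * sigma2 t k)
      = Z * (damping t k * sigma2 t (k - 1))
        + 2 * \<tau> * b * (damping t k * sigma3 t (k - 1) + (1 - damping t k) * sigma2 t k)"
      unfolding P_def by (simp only: algebra_simps)
    then show ?thesis
      unfolding sigma3_rec[OF k, symmetric] sigma2_rec[OF k(1), symmetric] P_def by simp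
  qed
  have A': "A' \<ge> 0" using A U \<tau> by (simp add: A'_def)
  have P0: "P k \<ge> 0" if "1 \<le> k" "k \<le> n" for k
    using sigma_nonneg[of k] that n \<tau> b by (simp add: P_def Z_def)
  have P1: "\<bar>diffq t (e w) 1\<bar> \<le> P 1" by (simp add: P_def Z_def sigma_1[simplified])
  show "\<bar>e w k\<bar> \<le> X"
    "\<bar>diffq t (e w) k\<bar> \<le> L * X + A' + (Z * sigma2 t k + 2 * \<tau> * b * sigma3 t k)"
    using stability[OF L order_refl n A' g P1 P P0 W k] by (simp_all add: X_def P_def)
qed

text \<open>The recursion now starts from the difference quotient at index 2, whereas
  \<open>sigma2\<close> is normalised at index 1. The homogeneous part is therefore majorised by
  \<open>(1 / 2)^(k - 2)\<close>, whose sum from 3 on is at most 1. The responses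
  \<open>sigma3\<close> and \<open>sigma4\<close> do not vanish at index 2, but they are nonnegative
  and may be added to the initial majorant. The coefficients 2 and 4 are the bounds for their
  sums.\<close>

lemma dc4_error:
  fixes v :: "real \<Rightarrow> real"
  defines "e \<equiv> \<lambda>w k. v (t k) - w k" and "R \<equiv> max 1 (max_ratio N t)"
  assumes L: "L > 0" "L * \<tau> \<le> 1 / 4" and lip: "\<forall>s\<in>{0..T}. L-lipschitz_on UNIV (f s)"
    and n: "3 \<le> n" "n \<le> N" and A: "A \<ge> 0" and U: "U \<ge> 0" and b: "b \<ge> 0" and c: "c \<ge> 0"
    and scheme: "\<forall>k\<in>{3..n}. bdf2_op t w k + corr24 f t w' k = f (t k) (w k)"
    and cons: "\<forall>k\<in>{3..n}. \<bar>bdf2_op t (\<lambda>k. v (t k)) k + dc4 t (\<lambda>k. f (t k) (v (t k))) k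
        - f (t k) (v (t k))\<bar> \<le> A"
    and \<delta>: "\<forall>k\<in>{1..n}. \<bar>diffq t (\<lambda>k. f (t k) (v (t k)) - f (t k) (w' k)) k\<bar>
        \<le> U + (b * sigma2 t k + c * sigma3 t k)"
  shows "\<bar>e w n\<bar> \<le> exp (2 * L * T) * (\<bar>e w 2\<bar> + (A + 6 * R * \<tau> * U) * t n
      + \<tau> * (\<bar>diffq t (e w) 2\<bar> + 6 * R * \<tau> * (2 * b + 4 * c)))"
proof -
  have \<tau>: "\<tau> \<ge> 0" using max_step_pos n by force
  have R: "R \<ge> 0" by (simp add: R_def)
  define Z where "Z = \<bar>diffq t (e w) 2\<bar>"
  define S where "S = (\<lambda>k. b * sigma2 t k + c * sigma3 t k)"
  define q where "q = 6 * R * \<tau>"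
  have q: "q \<ge> 0" using \<tau> R by (simp add: q_def)
  have g: "\<bar>bdf2_op t (e w) k\<bar> \<le> L * \<bar>e w k\<bar> + (A + q * U) + q * S k" if kn: "2 < k" "k \<le> n" for k
  proof -
    have k: "3 \<le> k" "k \<le> N" and mem: "k \<in> {3..n}" using kn n by auto
    have "\<bar>dc4 t (\<lambda>k. f (t k) (v (t k)) - f (t k) (w' k)) k\<bar> \<le> 6 * max 1 (max_ratio N t) * \<tau> * (U + S k)"
    proof (rule abs_dc4_le[OF k])
      show "\<bar>diffq t (\<lambda>k. f (t k) (v (t k)) - f (t k) (w' k)) j\<bar> \<le> U + S j"
        if "j \<in> {k - 2..k}" for j
        unfolding S_def by (rule bspec[OF \<delta>]) (use that kn in auto)
      show "S j \<ge> 0" if "j \<in> {k - 2..k}" for j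
      proof -
        have "1 \<le> j" "j \<le> N" using that k by auto
        then show ?thesis using sigma_nonneg[of j] b c by (simp add: S_def)
      qed
      show "damping t j * S (j - 1) \<le> S j" if "j \<in> {k - 1..k}" for j
      proof -
        have "2 \<le> j" "j \<le> N" using that k by auto
        from sigma_damping_le[OF this] show ?thesis
          using add_mono[OF mult_left_mono[OF _ b] mult_left_mono[OF _ c]]
          by (simp add: S_def distrib_left mult.left_commute)
      qed
    qed (rule U)
    then have "\<bar>bdf2_op t (e w) k\<bar> \<le> L * \<bar>e w k\<bar> + A + q * (U + S k)"
      unfolding e_def q_def R_def
      by (intro scheme_error_step[OF lip k(2), where c = "corr24 f t w' k"
            and c' = "dc4 t (\<lambda>k. f (t k) (v (t k))) k"])
        (use bspec[OF scheme mem] bspec[OF cons mem] corr24_eq[OF k, of f w'] in \<open>auto simp: dc4_diff\<close>)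
    then show ?thesis by (simp add: algebra_simps)
  qed
  define P where "P = (\<lambda>k. Z * (1 / 2)^(k - 2) + q * (b * sigma3 t k + c * sigma4 t k))"
  have W: "(\<Sum>k\<in>{2+1..n}. P k) \<le> Z + q * (2 * b + 4 * c)"
  proof -
    have n1: "1 \<le> n" using n by simp
    have sub: "(\<Sum>k\<in>{3..n}. x k) \<le> (\<Sum>k\<in>{2..n}. x k)" if "\<And>k. k \<in> {2..n} \<Longrightarrow> x k \<ge> 0" for x :: "nat \<Rightarrow> real"
      by (rule sum_mono2) (use that in auto)
    have "(\<Sum>k\<in>{2+1..n}. (1 / 2 :: real)^(k - 2)) + (1 / 2)^(n - 2) \<le> (1 / 2)^(2 - 2) + 2 * (\<Sum>k\<in>{2+1..n}. 0)"
    proof (rule sum_half_rec)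
      fix k :: nat assume "2 < k"
      then have "k - 2 = Suc (k - 1 - 2)" by simp
      then show "(1 / 2 :: real)^(k - 2) \<le> (1 / 2)^(k - 1 - 2) / 2 + 0" by simp
    qed (use n in auto)
    then have "(\<Sum>k\<in>{3..n}. (1 / 2 :: real)^(k - 2)) + (1 / 2)^(n - 2) \<le> 1" by simp
    moreover have "(0 :: real) \<le> (1 / 2)^(n - 2)" by simp
    ultimately have 1: "(\<Sum>k\<in>{3..n}. (1 / 2 :: real)^(k - 2)) \<le> 1" by linarith
    have 2: "(\<Sum>k\<in>{3..n}. sigma3 t k) \<le> 2" "(\<Sum>k\<in>{3..n}. sigma4 t k) \<le> 4"
      using sigma_sums[OF n1 n(2)] sub[of "sigma3 t"] sub[of "sigma4 t"] sigma_nonneg n by force+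
    have "(\<Sum>k\<in>{2+1..n}. P k) = Z * (\<Sum>k\<in>{3..n}. (1 / 2)^(k - 2))
        + q * (b * (\<Sum>k\<in>{3..n}. sigma3 t k) + c * (\<Sum>k\<in>{3..n}. sigma4 t k))"
      by (simp add: P_def sum.distrib sum_distrib_left distrib_left)
    also have "\<dots> \<le> Z * 1 + q * (b * 2 + c * 4)"
      using q b c 1 2 by (intro add_mono mult_left_mono) (auto simp: Z_def)
    finally show ?thesis by (simp add: mult.commute)
  qed
  have P: "damping t k * P (k - 1) + (1 - damping t k) * (q * S k) \<le> P k"
    if k2: "2 < k" "k \<le> n" for k
  proof -
    have k: "2 \<le> k" "k \<le> N" and k': "k - 2 = Suc (k - 1 - 2)" using k2 n by auto
    have "damping t k * (Z * (1 / 2)^(k - 1 - 2)) \<le> 1 / 2 * (Z * (1 / 2)^(k - 1 - 2))"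
      using damping_le[OF k] by (intro mult_right_mono) (auto simp: Z_def)
    also have "\<dots> = Z * (1 / 2)^(k - 2)" unfolding k' by simp
    finally have 1: "damping t k * (Z * (1 / 2)^(k - 1 - 2)) \<le> Z * (1 / 2)^(k - 2)" .
    have "damping t k * P (k - 1) + (1 - damping t k) * (q * S k)
      = damping t k * (Z * (1 / 2)^(k - 1 - 2))
        + q * (b * (damping t k * sigma3 t (k - 1) + (1 - damping t k) * sigma2 t k)
          + c * (damping t k * sigma4 t (k - 1) + (1 - damping t k) * sigma3 t k))"
      unfolding P_def S_def by (simp only: algebra_simps)
    then show ?thesis
      using 1 unfolding sigma3_rec[OF k, symmetric] sigma4_rec[OF k, symmetric] P_def by linarith
  qed
  have A': "A + q * U \<ge> 0" using A U q by simp
  have P0: "P k \<ge> 0" if "2 \<le> k" "k \<le> n" for k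
    using sigma_nonneg[of k] that n q b c by (simp add: P_def Z_def)
  have "0 \<le> q * (b * sigma3 t 2 + c * sigma4 t 2)"
    using sigma_nonneg[of 2] n q b c by simp
  then have P2: "\<bar>diffq t (e w) 2\<bar> \<le> P 2" by (simp add: P_def Z_def)
  have nn: "n \<in> {2..n}" and one: "(1::nat) \<le> 2" using n by auto
  show ?thesis
    using stability(1)[OF L one n(2) A' g P2 P P0 W nn] by (simp add: q_def Z_def)
qed

end

section \<open>Collection of the constants and the final estimate\<close>

lemma mult_le_absorb:
  fixes x y c :: real
  assumes "x \<le> c * G" "0 \<le> y" "y \<le> T" "0 \<le> x" "0 \<le> T"
  shows "x * y \<le> T * c * G"
  using mult_mono[OF assms(1,3)] assms by (simp add: ac_simps)

text \<open>The three estimates are chained with matching powers of \<tau>: \<open>c0\<close> to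
  \<open>c3\<close> bound \<tau>^2 X2, \<tau> A3 s, \<tau> X3 and \<tau> U3 s by multiples of
  \<open>G\<close>. Here \<open>s\<close> stands for t_n, and \<open>G\<close> is the final bound
  with the sigma terms removed; \<open>m1\<close> to \<open>m7\<close> are its seven summands.
  Factors of \<open>s\<close> beyond the one in \<open>m3\<close> are absorbed by \<open>T\<close>.
  Since \<open>R\<close> arises only in the last scheme, it enters linearly and \<open>C\<close>
  does not depend on it.\<close>

lemma error_constants:
  fixes E K L T Q2 Q3 :: real
  assumes const: "E \<ge> 1" "K \<ge> 0" "L \<ge> 0" "T \<ge> 0" "Q2 \<ge> 0" "Q3 \<ge> 0"
  defines "c0 \<equiv> E * (1 + K)"
  defines "c1 \<equiv> K + 2 * Q2 * ((2 + L) * (T * c0) + K)"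
  defines "c2 \<equiv> E * (2 + c1 + 4 * Q2)"
  defines "c3 \<equiv> Q3 * ((2 + L) * (T * c2) + c1)"
  defines "C \<equiv> E * (1 + K + 6 * c3 + 12 * Q3 + 48 * Q2 * Q3)"
  assumes \<tau>: "0 \<le> \<tau>" "\<tau> \<le> T" and s: "0 \<le> s" "s \<le> T" and R: "R \<ge> 1"
    and nonneg: "E21 \<ge> 0" "Z21 \<ge> 0" "E31 \<ge> 0" "Z31 \<ge> 0" "E42 \<ge> 0" "Z42 \<ge> 0"
  defines "X2 \<equiv> E * (E21 + K * \<tau>^2 * s + \<tau> * Z21)"
  defines "U2 \<equiv> Q2 * ((2 + L) * X2 + K * \<tau>^2)"
  defines "A3 \<equiv> K * \<tau>^3 + 2 * \<tau> * U2"
  defines "X3 \<equiv> E * (E31 + A3 * s + \<tau> * (Z31 + 4 * \<tau> * (Q2 * Z21)))"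
  defines "U3 \<equiv> Q3 * ((2 + L) * X3 + A3)"
  defines "G \<equiv> E42 + \<tau> * Z42 + s * \<tau>^4 + \<tau> * E31 + \<tau>^2 * Z31 + \<tau>^2 * E21 + \<tau>^3 * Z21"
  shows "E * (E42 + (K * R * \<tau>^4 + 6 * R * \<tau> * U3) * s
      + \<tau> * (Z42 + 6 * R * \<tau> * (2 * (Q3 * Z31) + 4 * (Q3 * (2 * \<tau> * (Q2 * Z21)))))) \<le> C * R * G"
    and "C > 0"
proof -
  define m1 m2 m3 m4 m5 m6 m7 where m: "m1 = E42" "m2 = \<tau> * Z42" "m3 = s * \<tau>^4" "m4 = \<tau> * E31"
    "m5 = \<tau>^2 * Z31" "m6 = \<tau>^2 * E21" "m7 = \<tau>^3 * Z21"
  have m0: "m1 \<ge> 0" "m2 \<ge> 0" "m3 \<ge> 0" "m4 \<ge> 0" "m5 \<ge> 0" "m6 \<ge> 0" "m7 \<ge> 0"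
    using nonneg \<tau> s by (auto simp: m)
  have G: "G = m1 + m2 + m3 + m4 + m5 + m6 + m7" by (simp add: G_def m)
  have mG: "m3 \<le> G" "m5 \<le> G" "m7 \<le> G" "m1 + m2 \<le> G" "m6 + m7 \<le> G" "m4 + m5 \<le> G" and G0: "G \<ge> 0"
    using m0 by (auto simp: G)
  have E0: "E \<ge> 0" using const by simp
  have X20: "X2 \<ge> 0" using E0 const nonneg \<tau> s by (simp add: X2_def)
  have U20: "U2 \<ge> 0" using X20 const by (simp add: U2_def)
  have A30: "A3 \<ge> 0" using U20 const \<tau> by (simp add: A3_def)
  have X30: "X3 \<ge> 0" using A30 E0 const nonneg \<tau> s by (simp add: X3_def)
  have U30: "U3 \<ge> 0" using X30 A30 const by (simp add: U3_def)
  have c0: "c0 \<ge> 0" using E0 const by (simp add: c0_def)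
  have c1: "c1 \<ge> 0" using c0 const by (simp add: c1_def)
  have c2: "c2 \<ge> 0" using E0 c1 const by (simp add: c2_def)
  have c3: "c3 \<ge> 0" using c1 c2 const by (simp add: c3_def)
  have K3: "K * m3 \<le> K * G" using mG const by (simp add: mult_left_mono)
  have "\<tau>^2 * X2 = E * ((m6 + m7) + K * m3)"
    by (simp add: X2_def m power2_eq_square power3_eq_cube power4_eq_xxxx algebra_simps)
  also have "\<dots> \<le> E * (G + K * G)" using mG K3 E0 const by (intro mult_left_mono add_mono) auto
  also have "\<dots> = c0 * G" by (simp add: c0_def algebra_simps)
  finally have "\<tau>^2 * X2 * s \<le> T * c0 * G"
    using s X20 const by (intro mult_le_absorb) auto
  then have X2: "(2 + L) * (\<tau>^2 * X2 * s) \<le> (2 + L) * (T * c0 * G)"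
    using const by (intro mult_left_mono) auto
  have "\<tau> * (A3 * s) = K * m3 + 2 * Q2 * ((2 + L) * (\<tau>^2 * X2 * s) + K * m3)"
    by (simp add: A3_def U2_def m power2_eq_square power3_eq_cube power4_eq_xxxx algebra_simps)
  also have "\<dots> \<le> K * G + 2 * Q2 * ((2 + L) * (T * c0 * G) + K * G)"
    using X2 K3 mG const by (intro add_mono mult_left_mono) auto
  also have "\<dots> = c1 * G" by (simp add: c1_def algebra_simps)
  finally have A3: "\<tau> * (A3 * s) \<le> c1 * G" .
  have "\<tau> * X3 = E * ((m4 + m5) + \<tau> * (A3 * s) + 4 * Q2 * m7)"
    by (simp add: X3_def m power2_eq_square power3_eq_cube algebra_simps)
  also have "\<dots> \<le> E * (G + c1 * G + 4 * Q2 * G)"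
    using mG A3 E0 const by (intro mult_left_mono add_mono) auto
  also have "\<dots> \<le> c2 * G"
    using G0 E0 by (simp add: c2_def algebra_simps)
  finally have "\<tau> * X3 * s \<le> T * c2 * G"
    using s X30 \<tau> const by (intro mult_le_absorb) auto
  then have X3: "(2 + L) * (\<tau> * X3 * s) \<le> (2 + L) * (T * c2 * G)"
    using const by (intro mult_left_mono) auto
  have "\<tau> * U3 * s = Q3 * ((2 + L) * (\<tau> * X3 * s) + \<tau> * (A3 * s))"
    by (simp add: U3_def algebra_simps)
  also have "\<dots> \<le> Q3 * ((2 + L) * (T * c2 * G) + c1 * G)"
    using X3 A3 const by (intro add_mono mult_left_mono) auto
  also have "\<dots> = c3 * G" by (simp add: c3_def algebra_simps)
  finally have U3: "\<tau> * U3 * s \<le> c3 * G" .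
  have "E * (E42 + (K * R * \<tau>^4 + 6 * R * \<tau> * U3) * s
      + \<tau> * (Z42 + 6 * R * \<tau> * (2 * (Q3 * Z31) + 4 * (Q3 * (2 * \<tau> * (Q2 * Z21))))))
    = E * ((m1 + m2) + R * (K * m3 + 6 * (\<tau> * U3 * s) + 12 * Q3 * m5 + 48 * Q2 * Q3 * m7))"
    by (simp add: m power2_eq_square power3_eq_cube algebra_simps)
  also have "\<dots> \<le> E * (R * G + R * (K * G + 6 * (c3 * G) + 12 * Q3 * G + 48 * Q2 * Q3 * G))"
  proof -
    have "m1 + m2 \<le> R * G" using mG mult_right_mono[OF R G0] by linarith
    then show ?thesis using mG K3 U3 E0 const R by (intro mult_left_mono add_mono) auto
  qed
  also have "\<dots> = C * R * G" by (simp add: C_def algebra_simps)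
  finally show "E * (E42 + (K * R * \<tau>^4 + 6 * R * \<tau> * U3) * s
      + \<tau> * (Z42 + 6 * R * \<tau> * (2 * (Q3 * Z31) + 4 * (Q3 * (2 * \<tau> * (Q2 * Z21)))))) \<le> C * R * G" .
  have "0 \<le> K + 6 * c3 + 12 * Q3 + 48 * Q2 * Q3" using const c3 by simp
  then show "C > 0" unfolding C_def using const by (intro mult_pos_pos) auto
qed

theorem theorem3p2:
  fixes f :: "real \<Rightarrow> real \<Rightarrow> real" and v :: "real \<Rightarrow> real" and T v0 Lf M :: real
  assumes T: "T > 0"
    and Lf: "Lf > 0"
    and f_lipschitz: "\<forall>s\<in>{0..T}. Lf-lipschitz_on UNIV (f s)"
    and f_C2: "C2_on ({0..T} \<times> UNIV) (\<lambda>(s, x). f s x)"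
    and v_sol: "solves_ivp f T v0 v"
    and v_C5: "Ck_on 5 {0<..T} v"
    and v_C5_bounded: "bounded (deriv_on 5 {0<..T} v ` {0<..T})"
  shows "\<exists>C>0. \<forall>N t v2 v3 v4.
    mesh T N t \<longrightarrow>
    max_step N t \<le> 1 / (4 * Lf) \<longrightarrow>
    bdf2_scheme f v0 N t v2 \<longrightarrow>
    bdf2_dc3_scheme f v0 N t v2 v3 \<longrightarrow>
    bdf2_dc3_dc4_scheme f v0 N t v3 v4 \<longrightarrow>
    start_accurate M v N t v2 \<longrightarrow>
    start_accurate M v N t v3 \<longrightarrow>
    (\<forall>n\<in>{3..N}.
      (let \<tau> = max_step N t; e2 = err v t v2; e3 = err v t v3; e4 = err v t v4 in
        \<bar>e4 n\<bar> \<le> C * max 1 (max_ratio N t) * exp (4 * Lf * t (n - 1)) *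
          (\<bar>e4 2\<bar> + \<tau> * \<bar>diffq t e4 2\<bar> + t n * \<tau> ^ 4
           + \<tau> * \<bar>e3 1\<bar> + \<tau> * (\<tau> + sigma3 t n) * \<bar>diffq t e3 1\<bar>
           + \<tau>\<^sup>2 * \<bar>e2 1\<bar> + \<tau>\<^sup>2 * (\<tau> + sigma4 t n) * \<bar>diffq t e2 1\<bar>)))"
proof -
  have v_cont: "continuous_on {0..T} v" and v_0: "v 0 = v0" using v_sol by (auto simp: solves_ivp_def)
  obtain Kv where v_lip: "Kv-lipschitz_on {0..T} v"
    using solution_lipschitz[OF f_C2 v_sol] .
  obtain B where B: "B \<ge> 0" and taylor: "quartic_expansion f v T B"
    using solution_taylor[OF T f_C2 v_sol v_C5 v_C5_bounded] by blast
  define K where "K = max (B * (1 + 2 * T + 48 * T^2)) (max (B * (1 + 64 * T)) (210 * B))"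
  have K: "K \<ge> 0" "B * (1 + 2 * T + 48 * T^2) \<le> K" "B * (1 + 64 * T) \<le> K" "210 * B \<le> K"
    using B by (auto simp: K_def)
  define E where "E = exp (2 * Lf * T)"
  have E: "E \<ge> 1" using T Lf by (simp add: E_def)
  \<comment> \<open>\<open>D2\<close> bounds the error of \<open>v2\<close> on every admissible
    mesh, using only \<open>M\<close>, \<open>K\<close>, \<open>T\<close> and \<open>Lf\<close>;
    \<open>D3\<close> does the same for \<open>v3\<close>, using also \<open>Q2\<close>. This allows
    \<open>Q2\<close> and \<open>Q3\<close>, hence \<open>C\<close>, to be chosen before the
    mesh.\<close>
  define D2 where "D2 = E * (\<bar>M\<bar> + K * T^3)"
  obtain Q2 where Q2: "Q2 \<ge> 0" "mixed_difference_bound f v T D2 Q2"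
    using C2_on_mixed_difference_bound[OF f_C2 v_cont v_lip, of D2] by blast
  define U2' where "U2' = Q2 * ((2 + Lf) * D2 + K * T^2)"
  define D3 where "D3 = E * (\<bar>M\<bar> + (K * T^3 + 2 * T * U2') * T + 4 * T * Q2 * \<bar>M\<bar>)"
  obtain Q3 where Q3: "Q3 \<ge> 0" "mixed_difference_bound f v T D3 Q3"
    using C2_on_mixed_difference_bound[OF f_C2 v_cont v_lip, of D3] by blast
  note const_bounds = E K(1) less_imp_le[OF Lf] less_imp_le[OF T] Q2(1) Q3(1)
  define c0 where "c0 = E * (1 + K)"
  define c1 where "c1 = K + 2 * Q2 * ((2 + Lf) * (T * c0) + K)"
  define c2 where "c2 = E * (2 + c1 + 4 * Q2)"
  define c3 where "c3 = Q3 * ((2 + Lf) * (T * c2) + c1)"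
  define C where "C = E * (1 + K + 6 * c3 + 12 * Q3 + 48 * Q2 * Q3)"
  note c_defs = c0_def c1_def c2_def c3_def C_def
  \<comment> \<open>Positivity is needed before any mesh is given, so the mesh data are replaced by
    zeros and the ratio by 1.\<close>
  have C_pos: "C > 0"
    using error_constants(2)[OF const_bounds, of 0 0 1 0 0 0 0 0 0] T unfolding c_defs by simp
  have bound: "\<bar>e4 n\<bar> \<le> C * max 1 (max_ratio N t) * exp (4 * Lf * t (n - 1)) *
          (\<bar>e4 2\<bar> + \<tau> * \<bar>diffq t e4 2\<bar> + t n * \<tau> ^ 4
           + \<tau> * \<bar>e3 1\<bar> + \<tau> * (\<tau> + sigma3 t n) * \<bar>diffq t e3 1\<bar>
           + \<tau>\<^sup>2 * \<bar>e2 1\<bar> + \<tau>\<^sup>2 * (\<tau> + sigma4 t n) * \<bar>diffq t e2 1\<bar>)"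
    if mesh: "mesh T N t" and step: "max_step N t \<le> 1 / (4 * Lf)"
      and s2: "bdf2_scheme f v0 N t v2" and s3: "bdf2_dc3_scheme f v0 N t v2 v3"
      and s4: "bdf2_dc3_dc4_scheme f v0 N t v3 v4"
      and start2: "start_accurate M v N t v2" and start3: "start_accurate M v N t v3"
      and n: "n \<in> {3..N}" and \<tau>: "\<tau> = max_step N t"
      and e: "e2 = err v t v2" "e3 = err v t v3" "e4 = err v t v4"
    for N t v2 v3 v4 n \<tau> e2 e3 e4
  proof -
    interpret mesh_on T N t by unfold_locales (rule mesh)
    have n3: "3 \<le> n" "n \<le> N" "1 \<le> N" and n_mem: "1 \<in> {1..n}" using n by auto
    have \<tau>0: "0 \<le> \<tau>" "\<tau> \<le> T"
      using less_imp_le[OF max_step_pos[OF n3(3)]] max_step_le[OF n3(3)] by (simp_all add: \<tau>)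
    have L\<tau>: "Lf * max_step N t \<le> 1 / 4" using step Lf by (simp add: field_simps)
    have tn: "0 \<le> t n" "t n \<le> T" using t_range[of n] n3 by auto
    have init: "v2 0 = v 0" "v3 0 = v 0" "v4 0 = v 0"
      using s2 s3 s4 v_0 by (auto simp: bdf2_scheme_def bdf2_dc3_scheme_def bdf2_dc3_dc4_scheme_def)
    have e': "e2 = (\<lambda>k. v (t k) - v2 k)" "e3 = (\<lambda>k. v (t k) - v3 k)" "e4 = (\<lambda>k. v (t k) - v4 k)"
      unfolding e by (rule err_eq, rule init)+
    have e_0: "e2 0 = 0" "e3 0 = 0" using e by (simp_all add: err_def)
    define R where "R = max 1 (max_ratio N t)"
    have R: "R \<ge> 1" by (simp add: R_def)
    note cons = consistency[OF B taylor]
    have cons2: "\<bar>bdf2_op t (\<lambda>k. v (t k)) k - f (t k) (v (t k))\<bar> \<le> K * \<tau>^2"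
      if "k \<in> {2..n}" for k
    proof -
      have "2 \<le> k" "k \<le> N" using that n3 by auto
      from order_trans[OF cons(1)[OF this] mult_right_mono[OF K(2)]] show ?thesis
        unfolding \<tau> by simp
    qed
    have cons3: "\<bar>bdf2_op t (\<lambda>k. v (t k)) k + dc3 t (\<lambda>k. f (t k) (v (t k))) k - f (t k) (v (t k))\<bar>
        \<le> K * \<tau>^3" if "k \<in> {2..n}" for k
    proof -
      have "2 \<le> k" "k \<le> N" using that n3 by auto
      from order_trans[OF cons(2)[OF this] mult_right_mono[OF K(3)]] show ?thesis
        using \<tau>0 unfolding \<tau> by simp
    qed
    have cons4: "\<bar>bdf2_op t (\<lambda>k. v (t k)) k + dc4 t (\<lambda>k. f (t k) (v (t k))) k - f (t k) (v (t k))\<bar>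
        \<le> K * R * \<tau>^4" if "k \<in> {3..n}" for k
    proof -
      have "2 \<le> k" "k \<le> N" "3 \<le> k" using that n3 by auto
      from cons(3)[OF this] have "\<bar>bdf2_op t (\<lambda>k. v (t k)) k + dc4 t (\<lambda>k. f (t k) (v (t k))) k
          - f (t k) (v (t k))\<bar> \<le> 210 * B * R * \<tau>^4"
        unfolding R_def \<tau> .
      also have "\<dots> \<le> K * R * \<tau>^4"
        using K(4) R \<tau>0 by (intro mult_right_mono) auto
      finally show ?thesis .
    qed
    define E21 where "E21 = \<bar>e2 1\<bar>"
    define Z21 where "Z21 = \<bar>diffq t e2 1\<bar>"
    define E31 where "E31 = \<bar>e3 1\<bar>"
    define Z31 where "Z31 = \<bar>diffq t e3 1\<bar>"
    define E42 where "E42 = \<bar>e4 2\<bar>"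
    define Z42 where "Z42 = \<bar>diffq t e4 2\<bar>"
    note Z_defs = E21_def Z21_def E31_def Z31_def E42_def Z42_def
    have nonneg: "E21 \<ge> 0" "Z21 \<ge> 0" "E31 \<ge> 0" "Z31 \<ge> 0" "E42 \<ge> 0" "Z42 \<ge> 0"
      unfolding Z_defs by (rule abs_ge_zero)+
    \<comment> \<open>Exactly the combination in which the starting error enters \<open>X2\<close>
      and \<open>X3\<close>: the starting difference quotient always carries a factor \<tau>, so it
      need not be bounded by itself.\<close>
    have start: "E21 + \<tau> * Z21 \<le> \<bar>M\<bar>" "E31 + \<tau> * Z31 \<le> \<bar>M\<bar>"
      using start2 start3 abs_ge_self[of M] unfolding start_accurate_def Z_defs \<tau> e by linarith+
    define X2 where "X2 = E * (E21 + K * \<tau>^2 * t n + \<tau> * Z21)"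
    have K2: "0 \<le> K * \<tau>^2" and K3: "0 \<le> K * \<tau>^3" and K4: "0 \<le> K * R * \<tau>^4"
      using K(1) \<tau>0 R by simp_all
    have scheme2: "\<forall>k\<in>{2..n}. bdf2_op t v2 k = f (t k) (v2 k)"
      and scheme3: "\<forall>k\<in>{2..n}. bdf2_op t v3 k + corr23 f t v2 k = f (t k) (v3 k)"
      and scheme4: "\<forall>k\<in>{3..n}. bdf2_op t v4 k + corr24 f t v3 k = f (t k) (v4 k)"
      using s2 s3 s4 n3 by (auto simp: bdf2_scheme_def bdf2_dc3_scheme_def bdf2_dc3_dc4_scheme_def)
    have e2: "\<bar>e2 k\<bar> \<le> X2" "\<bar>diffq t e2 k\<bar> \<le> Lf * X2 + K * \<tau>^2 + Z21 * sigma2 t k" if "k \<in> {1..n}" for k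
      using bdf2_error[OF Lf L\<tau> f_lipschitz n3(2) K2 scheme2 ballI[OF cons2] that]
      unfolding e' X2_def E_def E21_def Z21_def \<tau> by simp_all
    have X2_0: "0 \<le> X2" using e2(1)[OF n_mem] by linarith
    \<comment> \<open>Stability covers indices from 1 on; index 0, where the error vanishes, is
      added because the difference quotient at 1 reaches back to it.\<close>
    have e2': "\<bar>v (t k) - v2 k\<bar> \<le> X2" if "k \<le> n" for k
      using e2(1)[of k] e_0(1) X2_0 that unfolding e'(1) by (cases "k = 0") auto
    have X2_D2: "X2 \<le> D2"
    proof -
      have "K * \<tau>^2 * t n \<le> K * T^2 * T"
        using \<tau>0 tn K(1) T by (intro mult_mono power_mono mult_left_mono) auto
      also have "\<dots> = K * T^3" by (simp add: power2_eq_square power3_eq_cube)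
      finally have "E21 + K * \<tau>^2 * t n + \<tau> * Z21 \<le> \<bar>M\<bar> + K * T^3" using start(1) by linarith
      then show ?thesis unfolding X2_def D2_def using E by (intro mult_left_mono) auto
    qed
    define U2 where "U2 = Q2 * ((2 + Lf) * X2 + K * \<tau>^2)"
    have U2_0: "U2 \<ge> 0" using Q2(1) X2_0 K2 Lf by (simp add: U2_def)
    have \<delta>2: "\<bar>diffq t (\<lambda>k. f (t k) (v (t k)) - f (t k) (v2 k)) k\<bar> \<le> U2 + (Q2 * Z21) * sigma2 t k"
      if k: "k \<in> {1..n}" for k
    proof -
      have k': "1 \<le> k" "k \<le> N" "k \<le> n" "k - 1 \<le> n" using k n3 by auto
      show ?thesis
        using diffq_rhs_difference_le[OF Q2 k'(1,2) X2_D2 e2'[OF k'(3)] e2'[OF k'(4)]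
            e2(2)[OF k, unfolded e'(1)]]
        unfolding U2_def by (simp only: mult.assoc)
    qed
    define A3 where "A3 = K * \<tau>^3 + 2 * \<tau> * U2"
    have A3_0: "A3 \<ge> 0" using K3 U2_0 \<tau>0 by (simp add: A3_def)
    define X3 where "X3 = E * (E31 + A3 * t n + \<tau> * (Z31 + 4 * \<tau> * (Q2 * Z21)))"
    have b2: "0 \<le> Q2 * Z21" and b3: "0 \<le> Q3 * Z31" and b3': "0 \<le> Q3 * (2 * \<tau> * (Q2 * Z21))"
      using Q2(1) Q3(1) nonneg \<tau>0 by simp_all
    have e3: "\<bar>e3 k\<bar> \<le> X3"
      "\<bar>diffq t e3 k\<bar> \<le> Lf * X3 + A3 + (Z31 * sigma2 t k + 2 * \<tau> * (Q2 * Z21) * sigma3 t k)"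
      if "k \<in> {1..n}" for k
      using dc3_error[OF Lf L\<tau> f_lipschitz n3(2) K3 U2_0 b2 scheme3 ballI[OF cons3] ballI[OF \<delta>2] that]
      unfolding e' X3_def A3_def E_def E31_def Z31_def \<tau> by simp_all
    have X3_0: "0 \<le> X3" using e3(1)[OF n_mem] by linarith
    have e3': "\<bar>v (t k) - v3 k\<bar> \<le> X3" if "k \<le> n" for k
      using e3(1)[of k] e_0(2) X3_0 that unfolding e'(2) by (cases "k = 0") auto
    have X3_D3: "X3 \<le> D3"
    proof -
      have "U2 \<le> U2'"
        unfolding U2_def U2'_def using X2_D2 Q2(1) K(1) Lf \<tau>0
        by (intro mult_left_mono add_mono power_mono) auto
      then have "A3 \<le> K * T^3 + 2 * T * U2'"
        unfolding A3_def using \<tau>0 K(1) U2_0 T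
        by (intro add_mono mult_left_mono mult_mono power_mono) auto
      then have 1: "A3 * t n \<le> (K * T^3 + 2 * T * U2') * T"
        using tn A3_0 by (intro mult_mono) auto
      have "\<tau> * Z21 \<le> \<bar>M\<bar>" using start(1) nonneg(1) by linarith
      then have "(4 * \<tau> * Q2) * (\<tau> * Z21) \<le> (4 * T * Q2) * \<bar>M\<bar>"
        using \<tau>0 Q2(1) nonneg T by (intro mult_mono) auto
      then have 2: "\<tau> * (4 * \<tau> * (Q2 * Z21)) \<le> 4 * T * Q2 * \<bar>M\<bar>" by (simp add: ac_simps)
      have "E31 + A3 * t n + \<tau> * (Z31 + 4 * \<tau> * (Q2 * Z21))
          \<le> \<bar>M\<bar> + (K * T^3 + 2 * T * U2') * T + 4 * T * Q2 * \<bar>M\<bar>"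
        unfolding distrib_left[of \<tau>] using start(2) 1 2 by linarith
      then show ?thesis unfolding X3_def D3_def using E by (intro mult_left_mono) auto
    qed
    define U3 where "U3 = Q3 * ((2 + Lf) * X3 + A3)"
    have U3_0: "U3 \<ge> 0" using Q3(1) X3_0 A3_0 Lf by (simp add: U3_def)
    have \<delta>3: "\<bar>diffq t (\<lambda>k. f (t k) (v (t k)) - f (t k) (v3 k)) k\<bar>
        \<le> U3 + ((Q3 * Z31) * sigma2 t k + (Q3 * (2 * \<tau> * (Q2 * Z21))) * sigma3 t k)"
      if k: "k \<in> {1..n}" for k
    proof -
      have k': "1 \<le> k" "k \<le> N" "k \<le> n" "k - 1 \<le> n" using k n3 by auto
      show ?thesis
        using diffq_rhs_difference_le[OF Q3 k'(1,2) X3_D3 e3'[OF k'(3)] e3'[OF k'(4)]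
            e3(2)[OF k, unfolded e'(2)]]
        unfolding U3_def by (simp only: distrib_left[of Q3 "Z31 * _"] mult.assoc)
    qed
    define G where "G = E42 + \<tau> * Z42 + t n * \<tau>^4 + \<tau> * E31 + \<tau>^2 * Z31 + \<tau>^2 * E21 + \<tau>^3 * Z21"
    have G0: "G \<ge> 0" using nonneg \<tau>0 tn by (simp add: G_def)
    have "\<bar>e4 n\<bar> \<le> E * (E42 + (K * R * \<tau>^4 + 6 * R * \<tau> * U3) * t n
      + \<tau> * (Z42 + 6 * R * \<tau> * (2 * (Q3 * Z31) + 4 * (Q3 * (2 * \<tau> * (Q2 * Z21))))))"
      using dc4_error[OF Lf L\<tau> f_lipschitz n3(1,2) K4 U3_0 b3 b3' scheme4 ballI[OF cons4] ballI[OF \<delta>3]]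
      unfolding e' E_def E42_def Z42_def R_def \<tau> by simp
    also have "\<dots> \<le> C * R * G"
      unfolding U3_def X3_def A3_def U2_def X2_def G_def c_defs
      by (rule error_constants(1)[OF const_bounds \<tau>0 tn R nonneg])
    \<comment> \<open>The Gronwall factor exp (2 Lf T) is already part of \<open>C\<close>. The
      stated form follows because its exponential is at least 1 and \<open>sigma3\<close> and
      \<open>sigma4\<close> are nonnegative.\<close>
    also have "\<dots> \<le> (C * R * exp (4 * Lf * t (n - 1))) * (E42 + \<tau> * Z42 + t n * \<tau>^4 + \<tau> * E31
        + \<tau> * (\<tau> + sigma3 t n) * Z31 + \<tau>^2 * E21 + \<tau>^2 * (\<tau> + sigma4 t n) * Z21)"
    proof (rule mult_mono)
      have "0 \<le> t (n - 1)" using t_range[of "n - 1"] n3 by simp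
      then have "1 \<le> exp (4 * Lf * t (n - 1))" using Lf by simp
      then show "C * R \<le> C * R * exp (4 * Lf * t (n - 1))"
        using C_pos R mult_left_mono[of 1 _ "C * R"] by simp
      have "0 \<le> \<tau> * (sigma3 t n * Z31)" "0 \<le> \<tau>^2 * (sigma4 t n * Z21)"
        using sigma_nonneg[of n] n3 \<tau>0 nonneg by auto
      then show "G \<le> E42 + \<tau> * Z42 + t n * \<tau>^4 + \<tau> * E31
        + \<tau> * (\<tau> + sigma3 t n) * Z31 + \<tau>^2 * E21 + \<tau>^2 * (\<tau> + sigma4 t n) * Z21"
        by (simp add: G_def power2_eq_square power3_eq_cube algebra_simps)
    qed (use C_pos R G0 in auto)
    finally show ?thesis by (simp only: R_def Z_defs)
  qed
  show ?thesis
    unfolding Let_def by (intro exI[of _ C] conjI C_pos allI impI ballI bound) (rule refl | assumption)+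
qed

end
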